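(* Let $f,g$ be two bounded functions in $h^{2}(\mathbb{T}^{2})$. Then $\widehat{T}_f\widehat{T}_g=\widehat{T}_{fg}$ if and only if one of the following conditions is satisfied: (A) $f_{+}$ and $g_{+}$ are functions of the one variable $z_{1}$, and $f_{-}$ and $g_{-}$ are functions of the one variable $z_{2}$; or (B) $f_{+}$ and $g_{+}$ are functions of the one variable $z_{2}$, and $f_{-}$ and $g_{-}$ are functions of the one variable $z_{1}$; or (C) either $f$ or $g$ is constant.
   Context: $\mathbb{T}$ is the unit circle in $\mathbb{C}$, $\mathbb{T}^2=\mathbb{T}\times\mathbb{T}$ has points $z=(z_1,z_2)$, and $d\sigma$ is the normalized Haar measure on $\mathbb{T}^2$. $H^2(\mathbb{T}^2)$ is the closure of the analytic polynomials (in $z_1,z_2$) in $L^2(\mathbb{T}^2,d\sigma)$. The pluriharmonic Hardy space is $h^{2}(\mathbb{T}^{2})=H^{2}(\mathbb{T}^{2})+\overline{H^{2}(\mathbb{T}^{2})}$, a closed subspace of $L^2(\mathbb{T}^2,d\sigma)$ with the $L^2$ inner product. Let $Q$ be the orthogonal projection of $L^2(\mathbb{T}^2)$ onto $h^2(\mathbb{T}^2)$ and $P$ the orthogonal projection of $L^2(\mathbb{T}^2)$ onto $H^2(\mathbb{T}^2)$. For $f\in L^2(\mathbb{T}^2)$ put $f_{+}=Pf$ and $f_{-}=(Q-P)f$. For $f\in L^{2}(\mathbb{T}^{2})$ the Toeplitz operator $\widehat{T}_f$ on $h^2(\mathbb{T}^2)$ is densely defined by $\widehat{T}_f h=Q(fh)$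 for polynomials $h\in h^2(\mathbb{T}^2)$; if $f$ is bounded (i.e. in $L^\infty(\mathbb{T}^2)$), it is a bounded operator given by $\widehat{T}_f h=Q(fh)$ for all $h\in h^2(\mathbb{T}^2)$. "Function of the one variable $z_i$" means depending only on $z_i$ (almost everywhere); constants are included. *)

theory Defs
  imports "HOL-Probability.Probability"
begin

text \<open>Elements of \<open>L\<^sup>2(T\<^sup>2)\<close> are represented by functions on \<open>complex \<times> complex\<close>, of which only the
  values on the torus matter. Functions that agree almost everywhere are not identified, so
  equalities between elements of \<open>L\<^sup>2(T\<^sup>2)\<close> are stated almost everywhere.\<close>

definition circle_haar :: "complex measure" where
  "circle_haar =
     distr (uniform_measure lborel {0..1::real}) (restrict_space borel (sphere 0 1))
       (\<lambda>t. cis (2 * pi * t))"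

definition torus_haar :: "(complex \<times> complex) measure" where
  "torus_haar = circle_haar \<Otimes>\<^sub>M circle_haar"

definition L2_torus :: "(complex \<times> complex \<Rightarrow> complex) set" where
  "L2_torus = {f \<in> borel_measurable torus_haar. integrable torus_haar (\<lambda>z. (cmod (f z))\<^sup>2)}"

definition Linf_torus :: "(complex \<times> complex \<Rightarrow> complex) set" where
  "Linf_torus = {f \<in> borel_measurable torus_haar. \<exists>C. AE z in torus_haar. cmod (f z) \<le> C}"

definition L2_inner :: "(complex \<times> complex \<Rightarrow> complex) \<Rightarrow> (complex \<times> complex \<Rightarrow> complex) \<Rightarrow> complex"
  where "L2_inner f g = (LINT z|torus_haar. f z * cnj (g z))"

definition L2_norm :: "(complex \<times> complex \<Rightarrow> complex) \<Rightarrow> real" where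
  "L2_norm f = sqrt (LINT z|torus_haar. (cmod (f z))\<^sup>2)"

definition analytic_polys :: "(complex \<times> complex \<Rightarrow> complex) set" where
  "analytic_polys =
     {(\<lambda>z. \<Sum>j\<le>n. \<Sum>k\<le>n. c j k * fst z ^ j * snd z ^ k) | (n :: nat) (c :: nat \<Rightarrow> nat \<Rightarrow> complex). True}"

definition H2_torus :: "(complex \<times> complex \<Rightarrow> complex) set" where
  "H2_torus = {f \<in> L2_torus. \<forall>e>0. \<exists>p\<in>analytic_polys. L2_norm (\<lambda>z. f z - p z) < e}"

definition h2_torus :: "(complex \<times> complex \<Rightarrow> complex) set" where
  "h2_torus = {(\<lambda>z. u z + cnj (v z)) | u v. u \<in> H2_torus \<and> v \<in> H2_torus}"

text \<open>For a closed subspace \<open>S\<close> the projection exists and is unique almost everywhere; the choice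
  operator only selects a representative.\<close>

definition orth_proj ::
  "(complex \<times> complex \<Rightarrow> complex) set \<Rightarrow> (complex \<times> complex \<Rightarrow> complex) \<Rightarrow> complex \<times> complex \<Rightarrow> complex"
  where "orth_proj S f = (SOME p. p \<in> S \<and> (\<forall>h\<in>S. L2_inner (\<lambda>z. f z - p z) h = 0))"

definition P_proj :: "(complex \<times> complex \<Rightarrow> complex) \<Rightarrow> complex \<times> complex \<Rightarrow> complex" where
  "P_proj = orth_proj H2_torus"

definition Q_proj :: "(complex \<times> complex \<Rightarrow> complex) \<Rightarrow> complex \<times> complex \<Rightarrow> complex" where
  "Q_proj = orth_proj h2_torus"

definition plus_part :: "(complex \<times> complex \<Rightarrow> complex) \<Rightarrow> complex \<times> complex \<Rightarrow> complex" where
  "plus_part f = P_proj f"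

definition minus_part :: "(complex \<times> complex \<Rightarrow> complex) \<Rightarrow> complex \<times> complex \<Rightarrow> complex" where
  "minus_part f = (\<lambda>z. Q_proj f z - P_proj f z)"

text \<open>The operator is only meaningful for symbols in \<open>Linf_torus\<close> and arguments in \<open>h2_torus\<close>.\<close>

definition toeplitz ::
  "(complex \<times> complex \<Rightarrow> complex) \<Rightarrow> (complex \<times> complex \<Rightarrow> complex) \<Rightarrow> complex \<times> complex \<Rightarrow> complex"
  where "toeplitz f h = Q_proj (\<lambda>z. f z * h z)"

definition depends_only_z1 :: "(complex \<times> complex \<Rightarrow> complex) \<Rightarrow> bool" where
  "depends_only_z1 f \<longleftrightarrow>
     (\<exists>\<phi>\<in>borel_measurable circle_haar. AE z in torus_haar. f z = \<phi> (fst z))"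

definition depends_only_z2 :: "(complex \<times> complex \<Rightarrow> complex) \<Rightarrow> bool" where
  "depends_only_z2 f \<longleftrightarrow>
     (\<exists>\<phi>\<in>borel_measurable circle_haar. AE z in torus_haar. f z = \<phi> (snd z))"

definition ae_constant :: "(complex \<times> complex \<Rightarrow> complex) \<Rightarrow> bool" where
  "ae_constant f \<longleftrightarrow> (\<exists>c. AE z in torus_haar. f z = c)"

lemma prob_space_circle_haar: "prob_space circle_haar"
proof -
  interpret prob_space "uniform_measure lborel {0..1::real}"
    by (rule prob_space_uniform_measure) auto
  have "(\<lambda>t. cis (2 * pi * t)) \<in> borel_measurable borel"
    by (intro borel_measurable_continuous_onI continuous_intros)
  then have "(\<lambda>t. cis (2 * pi * t)) \<in>
      measurable (uniform_measure lborel {0..1::real}) (restrict_space borel (sphere 0 1))"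
    by (intro measurable_restrict_space2) auto
  then show ?thesis
    unfolding circle_haar_def by (rule prob_space_distr)
qed

end

theory Submission
  imports Defs
begin

text \<open>
  In Fourier coefficients everything becomes a statement about two arrays on \<open>\<int>\<^sup>2\<close>. The space \<open>h\<^sup>2\<close>
  consists of the functions whose spectrum lies in the set \<open>\<Lambda>\<close> of lattice points with both coordinates
  of the same sign (\<open>h2_torus_eq\<close>), and \<open>Q\<close> cuts the spectrum down to \<open>\<Lambda>\<close>
  (\<open>orth_proj_closed_span\<close>). Let \<open>a\<close> and \<open>b\<close> be the coefficients of \<open>f\<close> and \<open>g\<close>. The defect
  \<open>T\<^sub>f T\<^sub>g - T\<^sub>f\<^sub>g\<close> sends \<open>h\<close> to \<open>- Q (f (gh - Q (gh)))\<close>, so its matrix entry from \<open>\<gamma> \<in> \<Lambda>\<close> to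
  \<open>\<delta> \<in> \<Lambda>\<close> is, up to sign, the sum of \<open>a (\<delta> - \<mu>) * b (\<mu> - \<gamma>)\<close> over \<open>\<mu> \<notin> \<Lambda>\<close>: multiplication
  by \<open>g\<close> leaves \<open>\<Lambda>\<close> at \<open>\<mu>\<close>, and multiplication by \<open>f\<close> comes back.

  If one of (A), (B), (C) holds, every single summand vanishes. In case (A), for instance, \<open>a\<close> and \<open>b\<close>
  live on the half axes pointing right and down, a step that leaves \<open>\<Lambda>\<close> in those directions ends in the
  open quadrant on the lower right, and no such step leads back from there
  (\<open>no_transition_if_compatible\<close>).

  Conversely, suppose that all these sums vanish. Fix \<open>\<tau> = \<delta> - \<gamma>\<close> and compare the sums for
  neighbouring \<open>\<gamma>\<close>: the index sets differ by pieces of rows and columns, and second differences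
  isolate two neighbouring products \<open>a (\<tau> - \<beta>) * b \<beta>\<close>. This has two consequences.

  First, for nonzero \<open>\<alpha>\<close> and \<open>\<beta>\<close> in the closed first quadrant, \<open>a \<alpha> * b (- \<beta>)\<close> can be nonzero only
  if \<open>\<alpha>\<close> and \<open>\<beta>\<close> lie on different coordinate axes (\<open>mixed_product_zero\<close>). The products along an
  antidiagonal alternate in sign, and combined with the vanishing of the row sums this kills all of them
  except the one at the corner (\<open>vanish_off_origin_if_corner_sums_0\<close>).

  Second, the row differences say that the power series of a row of \<open>a\<close> above the axis, multiplied by that
  of a row of \<open>b\<close> without its constant term, is zero. Power series form an integral domain, so \<open>f\<^sub>+\<close>
  depends only on \<open>z\<^sub>1\<close> or \<open>g\<^sub>+\<close> depends only on \<open>z\<^sub>2\<close> (\<open>analytic_product_dichotomy\<close>).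

  The condition on \<open>(a, b)\<close> is invariant under reflection in the origin, under exchange of the coordinates
  and under passing to adjoints. Applying the two consequences to the reflected pairs
  leaves exactly the three cases of the theorem (\<open>compatible_if_semicommuting\<close>).
\<close>

section \<open>The Hilbert space of square-integrable functions on the torus\<close>

interpretation circle: prob_space circle_haar
  by (rule prob_space_circle_haar)

interpretation torus_pair: pair_prob_space circle_haar circle_haar ..

interpretation torus: prob_space torus_haar
  unfolding torus_haar_def by (rule torus_pair.prob_space_axioms)

lemma space_circle_haar: "space circle_haar = sphere 0 1"
  by (simp add: circle_haar_def space_restrict_space)

lemma space_torus_haar: "space torus_haar = sphere 0 1 \<times> sphere 0 1"
  by (simp add: torus_haar_def space_pair_measure space_circle_haar)

lemma borel_measurable_circle_haar:
  "f \<in> borel_measurable borel \<Longrightarrow> f \<in> borel_measurable circle_haar"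
  by (simp add: circle_haar_def measurable_restrict_space1)

lemma measurable_fst_torus_haar [measurable]: "fst \<in> measurable torus_haar circle_haar"
  and measurable_snd_torus_haar [measurable]: "snd \<in> measurable torus_haar circle_haar"
  by (simp_all add: torus_haar_def)

lemma borel_measurable_cnj [measurable]: "cnj \<in> borel_measurable borel"
  by (intro borel_measurable_continuous_onI continuous_intros)

lemma L2_torusD:
  assumes "f \<in> L2_torus"
  shows "f \<in> borel_measurable torus_haar" "integrable torus_haar (\<lambda>z. (cmod (f z))\<^sup>2)"
  using assms by (auto simp: L2_torus_def)

lemma L2_torusI_le:
  assumes [measurable]: "f \<in> borel_measurable torus_haar"
    and "integrable torus_haar g" and "AE z in torus_haar. (cmod (f z))\<^sup>2 \<le> g z"
  shows "f \<in> L2_torus"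
proof -
  have "integrable torus_haar (\<lambda>z. (cmod (f z))\<^sup>2)"
    by (rule Bochner_Integration.integrable_bound[OF assms(2)]) (use assms(3) in auto)
  then show ?thesis by (simp add: L2_torus_def)
qed

lemma L2_torus_add:
  assumes "f \<in> L2_torus" "g \<in> L2_torus"
  shows "(\<lambda>z. f z + g z) \<in> L2_torus"
proof (rule L2_torusI_le)
  note [measurable] = L2_torusD(1)[OF assms(1)] L2_torusD(1)[OF assms(2)]
  show "(\<lambda>z. f z + g z) \<in> borel_measurable torus_haar" by simp
  show "integrable torus_haar (\<lambda>z. 2 * (cmod (f z))\<^sup>2 + 2 * (cmod (g z))\<^sup>2)"
    using assms[THEN L2_torusD(2)] by simp
  have "(cmod (f z + g z))\<^sup>2 \<le> 2 * (cmod (f z))\<^sup>2 + 2 * (cmod (g z))\<^sup>2" for z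
  proof -
    have "(cmod (f z + g z))\<^sup>2 \<le> (cmod (f z) + cmod (g z))\<^sup>2"
      by (intro power_mono norm_triangle_ineq) auto
    also have "\<dots> \<le> 2 * (cmod (f z))\<^sup>2 + 2 * (cmod (g z))\<^sup>2"
      using sum_squares_bound[of "cmod (f z)" "cmod (g z)"] by (simp add: power2_sum)
    finally show ?thesis .
  qed
  then show "AE z in torus_haar. (cmod (f z + g z))\<^sup>2 \<le> 2 * (cmod (f z))\<^sup>2 + 2 * (cmod (g z))\<^sup>2"
    by simp
qed

lemma L2_torus_cmult: "f \<in> L2_torus \<Longrightarrow> (\<lambda>z. c * f z) \<in> L2_torus"
  by (auto simp: L2_torus_def norm_mult power_mult_distrib)

lemma L2_torus_minus: "f \<in> L2_torus \<Longrightarrow> (\<lambda>z. - f z) \<in> L2_torus"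
  by (auto simp: L2_torus_def)

lemma L2_torus_diff: "f \<in> L2_torus \<Longrightarrow> g \<in> L2_torus \<Longrightarrow> (\<lambda>z. f z - g z) \<in> L2_torus"
  using L2_torus_add[OF _ L2_torus_minus, of f g] by simp

lemma L2_torus_zero: "(\<lambda>z. 0) \<in> L2_torus"
  by (simp add: L2_torus_def)

lemma L2_torus_sum: "(\<And>i. i \<in> I \<Longrightarrow> f i \<in> L2_torus) \<Longrightarrow> (\<lambda>z. \<Sum>i\<in>I. f i z) \<in> L2_torus"
  by (induction I rule: infinite_finite_induct) (auto simp: L2_torus_zero intro!: L2_torus_add)

lemma L2_torus_cnj: "f \<in> L2_torus \<Longrightarrow> (\<lambda>z. cnj (f z)) \<in> L2_torus"
  by (auto simp: L2_torus_def intro: measurable_compose[OF _ borel_measurable_cnj])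

lemma L2_torus_Linf_mult:
  assumes f: "f \<in> Linf_torus" and g: "g \<in> L2_torus"
  shows "(\<lambda>z. f z * g z) \<in> L2_torus"
proof -
  note [measurable] = L2_torusD(1)[OF g]
  from f obtain C where [measurable]: "f \<in> borel_measurable torus_haar"
    and C: "AE z in torus_haar. cmod (f z) \<le> C"
    by (auto simp: Linf_torus_def)
  show ?thesis
  proof (rule L2_torusI_le)
    show "integrable torus_haar (\<lambda>z. C\<^sup>2 * (cmod (g z))\<^sup>2)"
      using g by (auto dest: L2_torusD)
    show "AE z in torus_haar. (cmod (f z * g z))\<^sup>2 \<le> C\<^sup>2 * (cmod (g z))\<^sup>2"
      using C by eventually_elim (auto simp: norm_mult power_mult_distrib intro!: mult_right_mono power_mono)
  qed simp
qed

lemma integrable_L2_mult_cnj: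
  assumes "f \<in> L2_torus" "g \<in> L2_torus"
  shows "integrable torus_haar (\<lambda>z. f z * cnj (g z))"
proof (rule Bochner_Integration.integrable_bound)
  note [measurable] = L2_torusD(1)[OF assms(1)] L2_torusD(1)[OF assms(2)]
  show "integrable torus_haar (\<lambda>z. (cmod (f z))\<^sup>2 + (cmod (g z))\<^sup>2)"
    using assms[THEN L2_torusD(2)] by simp
  show "(\<lambda>z. f z * cnj (g z)) \<in> borel_measurable torus_haar" by measurable
  have "cmod (f z) * cmod (g z) \<le> (cmod (f z))\<^sup>2 + (cmod (g z))\<^sup>2" for z
    using sum_squares_bound[of "cmod (f z)" "cmod (g z)"]
      mult_nonneg_nonneg[OF norm_ge_zero[of "f z"] norm_ge_zero[of "g z"]] by linarith
  then show "AE z in torus_haar. norm (f z * cnj (g z)) \<le> norm ((cmod (f z))\<^sup>2 + (cmod (g z))\<^sup>2)"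
    by (simp add: norm_mult)
qed

lemma L2_inner_add_left:
  "f \<in> L2_torus \<Longrightarrow> g \<in> L2_torus \<Longrightarrow> h \<in> L2_torus \<Longrightarrow>
    L2_inner (\<lambda>z. f z + g z) h = L2_inner f h + L2_inner g h"
  by (simp add: L2_inner_def distrib_right integrable_L2_mult_cnj)

lemma L2_inner_diff_left:
  "f \<in> L2_torus \<Longrightarrow> g \<in> L2_torus \<Longrightarrow> h \<in> L2_torus \<Longrightarrow>
    L2_inner (\<lambda>z. f z - g z) h = L2_inner f h - L2_inner g h"
  by (simp add: L2_inner_def left_diff_distrib integrable_L2_mult_cnj)

lemma L2_inner_cmult_left: "L2_inner (\<lambda>z. c * f z) h = c * L2_inner f h"
  by (simp add: L2_inner_def mult.assoc)

lemma L2_inner_commute: "L2_inner f g = cnj (L2_inner g f)"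
proof -
  have "cnj (L2_inner g f) = (LINT z|torus_haar. cnj (g z * cnj (f z)))"
    unfolding L2_inner_def by (rule Bochner_Integration.integral_cnj[symmetric])
  also have "\<dots> = L2_inner f g"
    unfolding L2_inner_def by (simp add: mult.commute)
  finally show ?thesis ..
qed

lemma L2_inner_zero_left: "L2_inner (\<lambda>z. 0) h = 0"
  by (simp add: L2_inner_def)

lemma L2_inner_sum_left:
  assumes "\<And>i. i \<in> I \<Longrightarrow> f i \<in> L2_torus" "h \<in> L2_torus"
  shows "L2_inner (\<lambda>z. \<Sum>i\<in>I. f i z) h = (\<Sum>i\<in>I. L2_inner (f i) h)"
  using assms(1)
  by (induction I rule: infinite_finite_induct)
     (simp_all add: L2_inner_zero_left L2_inner_add_left L2_torus_sum assms(2))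

lemma L2_norm_cong:
  assumes "\<And>z. z \<in> space torus_haar \<Longrightarrow> f z = f' z"
  shows "L2_norm f = L2_norm f'"
  unfolding L2_norm_def
  by (rule arg_cong[of _ _ sqrt], rule Bochner_Integration.integral_cong) (simp_all add: assms)

lemma L2_inner_cong_AE:
  assumes "f \<in> L2_torus" "f' \<in> L2_torus" "h \<in> L2_torus" "AE z in torus_haar. f z = f' z"
  shows "L2_inner f h = L2_inner f' h"
  unfolding L2_inner_def
proof (rule integral_cong_AE)
  note [measurable] = L2_torusD(1)[OF assms(1)] L2_torusD(1)[OF assms(2)] L2_torusD(1)[OF assms(3)]
  show "(\<lambda>z. f z * cnj (h z)) \<in> borel_measurable torus_haar"
    "(\<lambda>z. f' z * cnj (h z)) \<in> borel_measurable torus_haar" by measurable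
qed (use assms(4) in auto)

lemma L2_norm_nonneg [simp]: "0 \<le> L2_norm f"
  by (simp add: L2_norm_def)

lemma L2_norm_power2: "(L2_norm f)\<^sup>2 = (LINT z|torus_haar. (cmod (f z))\<^sup>2)"
  by (simp add: L2_norm_def)

lemma L2_inner_self: "L2_inner f f = of_real ((L2_norm f)\<^sup>2)"
  unfolding L2_norm_power2 L2_inner_def integral_complex_of_real[symmetric]
  by (simp only: complex_norm_square)

lemma L2_norm_eq_0_iff:
  assumes "f \<in> L2_torus"
  shows "L2_norm f = 0 \<longleftrightarrow> (AE z in torus_haar. f z = 0)"
  using integral_nonneg_eq_0_iff_AE[OF L2_torusD(2)[OF assms]]
  by (simp add: L2_norm_def)

lemma L2_norm_cmult: "L2_norm (\<lambda>z. c * f z) = cmod c * L2_norm f"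
  by (simp add: L2_norm_def norm_mult power_mult_distrib real_sqrt_mult)

lemma L2_norm_diff_commute: "L2_norm (\<lambda>z. f z - g z) = L2_norm (\<lambda>z. g z - f z)"
  by (simp add: L2_norm_def norm_minus_commute)

lemma L2_norm_cnj: "L2_norm (\<lambda>z. cnj (f z)) = L2_norm f"
  by (simp add: L2_norm_def)

text \<open>Integrating \<open>2xy \<le> t x\<^sup>2 + y\<^sup>2 / t\<close> and choosing the optimal weight \<open>t\<close> gives the Cauchy--Schwarz
  inequality in a form that bounds both the inner product and the \<open>L\<^sup>1\<close> norm.\<close>

lemma integral_mult_le_L2_norm:
  assumes "f \<in> L2_torus" "g \<in> L2_torus"
  shows "(LINT z|torus_haar. cmod (f z) * cmod (g z)) \<le> L2_norm f * L2_norm g"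
proof -
  have int: "integrable torus_haar (\<lambda>z. cmod (f z) * cmod (g z))"
    using integrable_norm[OF integrable_L2_mult_cnj[OF assms]] by (simp add: norm_mult)
  have zero: "(LINT z|torus_haar. cmod (u z) * cmod (v z)) = 0"
    if "u \<in> L2_torus" "L2_norm u = 0" for u v
    using that by (intro integral_eq_zero_AE) (auto simp: L2_norm_eq_0_iff)
  show ?thesis
  proof (cases "L2_norm f = 0 \<or> L2_norm g = 0")
    case True
    then show ?thesis
      using zero[of f g] zero[of g f] assms by (auto simp: mult.commute)
  next
    case False
    define t where "t = L2_norm g / L2_norm f"
    have t: "t > 0"
      using False by (simp add: t_def less_le)
    have "(LINT z|torus_haar. cmod (f z) * cmod (g z)) \<le>
      (LINT z|torus_haar. t / 2 * (cmod (f z))\<^sup>2 + 1 / (2 * t) * (cmod (g z))\<^sup>2)"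
    proof (rule integral_mono[OF int])
      show "integrable torus_haar (\<lambda>z. t / 2 * (cmod (f z))\<^sup>2 + 1 / (2 * t) * (cmod (g z))\<^sup>2)"
        using assms[THEN L2_torusD(2)] by simp
      fix z
      have "0 \<le> (t * cmod (f z) - cmod (g z))\<^sup>2" by simp
      then show "cmod (f z) * cmod (g z) \<le> t / 2 * (cmod (f z))\<^sup>2 + 1 / (2 * t) * (cmod (g z))\<^sup>2"
        using t by (simp add: field_simps power2_eq_square)
    qed
    also have "\<dots> = t / 2 * (L2_norm f)\<^sup>2 + 1 / (2 * t) * (L2_norm g)\<^sup>2"
      using assms[THEN L2_torusD(2)] by (simp add: L2_norm_power2)
    also have "\<dots> = L2_norm f * L2_norm g"
      using False by (simp add: t_def field_simps power2_eq_square)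
    finally show ?thesis .
  qed
qed

lemma L2_Cauchy_Schwarz:
  assumes "f \<in> L2_torus" "g \<in> L2_torus"
  shows "cmod (L2_inner f g) \<le> L2_norm f * L2_norm g"
proof -
  have "cmod (L2_inner f g) \<le> (LINT z|torus_haar. cmod (f z) * cmod (g z))"
    unfolding L2_inner_def by (rule order_trans[OF integral_norm_bound]) (simp add: norm_mult)
  also note integral_mult_le_L2_norm[OF assms]
  finally show ?thesis .
qed

lemma L2_norm_add_power2:
  assumes "f \<in> L2_torus" "g \<in> L2_torus"
  shows "(L2_norm (\<lambda>z. f z + g z))\<^sup>2 = (L2_norm f)\<^sup>2 + 2 * Re (L2_inner f g) + (L2_norm g)\<^sup>2"
proof -
  have fg: "(\<lambda>z. f z + g z) \<in> L2_torus"
    using assms by (rule L2_torus_add)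
  have "L2_inner (\<lambda>z. f z + g z) (\<lambda>z. f z + g z) =
      L2_inner f (\<lambda>z. f z + g z) + L2_inner g (\<lambda>z. f z + g z)"
    by (rule L2_inner_add_left[OF assms fg])
  also have "L2_inner f (\<lambda>z. f z + g z) = cnj (L2_inner f f + L2_inner g f)"
    by (subst L2_inner_commute) (simp add: L2_inner_add_left assms)
  also have "L2_inner g (\<lambda>z. f z + g z) = cnj (L2_inner f g + L2_inner g g)"
    by (subst L2_inner_commute) (simp add: L2_inner_add_left assms)
  finally have "complex_of_real ((L2_norm (\<lambda>z. f z + g z))\<^sup>2) =
      cnj (L2_inner f f + L2_inner g f) + cnj (L2_inner f g + L2_inner g g)"
    by (simp only: L2_inner_self)
  from arg_cong[OF this, of Re] show ?thesis
    by (simp add: L2_inner_self L2_inner_commute[of g f])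
qed

lemma L2_norm_triangle:
  assumes "f \<in> L2_torus" "g \<in> L2_torus"
  shows "L2_norm (\<lambda>z. f z + g z) \<le> L2_norm f + L2_norm g"
proof (rule power2_le_imp_le)
  have "Re (L2_inner f g) \<le> L2_norm f * L2_norm g"
    using complex_Re_le_cmod L2_Cauchy_Schwarz[OF assms] by (rule order_trans)
  then show "(L2_norm (\<lambda>z. f z + g z))\<^sup>2 \<le> (L2_norm f + L2_norm g)\<^sup>2"
    by (simp add: L2_norm_add_power2 assms power2_sum)
qed simp

lemma L1_le_L2_norm:
  assumes "f \<in> L2_torus"
  shows "integrable torus_haar f" "(LINT z|torus_haar. cmod (f z)) \<le> L2_norm f"
proof -
  have one: "(\<lambda>z. 1) \<in> L2_torus" by (simp add: L2_torus_def)
  show "integrable torus_haar f"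
    using integrable_L2_mult_cnj[OF assms one] by simp
  show "(LINT z|torus_haar. cmod (f z)) \<le> L2_norm f"
    using integral_mult_le_L2_norm[OF assms one] by (simp add: L2_norm_def torus.prob_space)
qed

lemma L2_limit_imp_AE_subseq:
  assumes u: "\<And>n. u n \<in> L2_torus" and v: "v \<in> L2_torus"
    and lim: "(\<lambda>n. L2_norm (\<lambda>z. u n z - v z)) \<longlonglongrightarrow> 0"
  obtains r where "strict_mono r" "AE z in torus_haar. (\<lambda>n. u (r n) z) \<longlonglongrightarrow> v z"
proof -
  note [simp] = L2_torus_diff[OF u v]
  have "(\<lambda>n. LINT z|torus_haar. cmod (u n z - v z)) \<longlonglongrightarrow> 0"
    by (rule tendsto_sandwich[OF _ _ tendsto_const lim])
       (auto intro!: always_eventually L1_le_L2_norm(2)[where f = "\<lambda>z. u n z - v z" for n])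
  from tendsto_L1_AE_subseq[OF _ this] obtain r where
    r: "strict_mono r" "AE z in torus_haar. (\<lambda>n. u (r n) z - v z) \<longlonglongrightarrow> 0"
    using L1_le_L2_norm(1)[OF L2_torus_diff[OF u v]] by blast
  from r(2) have "AE z in torus_haar. (\<lambda>n. u (r n) z) \<longlonglongrightarrow> v z"
    by eventually_elim (simp add: LIM_zero_iff)
  with r(1) show ?thesis by (rule that)
qed

text \<open>The increments are summable in \<open>L\<^sup>1\<close> because the measure is finite, so they are absolutely summable at
  almost every point.\<close>

lemma AE_convergent_if_summable_L2:
  assumes u: "\<And>n. u n \<in> L2_torus"
    and bound: "\<And>n. L2_norm (\<lambda>z. u (Suc n) z - u n z) \<le> (1 / 2) ^ n"
  shows "AE z in torus_haar. convergent (\<lambda>n. u n z)"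
proof -
  define d where "d n z = u (Suc n) z - u n z" for n z
  have d: "d n \<in> L2_torus" for n
    unfolding d_def by (intro L2_torus_diff u)
  note [measurable] = L2_torusD(1)[OF d]
  have "(\<integral>\<^sup>+z. (\<Sum>n. ennreal (cmod (d n z))) \<partial>torus_haar) =
      (\<Sum>n. \<integral>\<^sup>+z. ennreal (cmod (d n z)) \<partial>torus_haar)"
    by (rule nn_integral_suminf) simp
  also have "\<dots> \<le> (\<Sum>n. ennreal ((1 / 2) ^ n))"
  proof (intro suminf_le summableI)
    fix n
    have "(\<integral>\<^sup>+z. ennreal (cmod (d n z)) \<partial>torus_haar) = ennreal (LINT z|torus_haar. cmod (d n z))"
      using L1_le_L2_norm[OF d] by (intro nn_integral_eq_integral) auto
    also have "\<dots> \<le> ennreal ((1 / 2) ^ n)"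
      using L1_le_L2_norm(2)[OF d, of n] bound[of n] by (intro ennreal_leI) (simp add: d_def[abs_def])
    finally show "(\<integral>\<^sup>+z. ennreal (cmod (d n z)) \<partial>torus_haar) \<le> ennreal ((1 / 2) ^ n)" .
  qed
  also have "\<dots> = ennreal (\<Sum>n. (1 / 2) ^ n)"
    by (rule suminf_ennreal2) (auto intro: summable_geometric)
  also have "\<dots> < \<infinity>" by simp
  finally have "AE z in torus_haar. (\<Sum>n. ennreal (cmod (d n z))) \<noteq> \<infinity>"
    by (intro nn_integral_PInf_AE) auto
  then show ?thesis
  proof eventually_elim
    case (elim z)
    then have "summable (\<lambda>n. cmod (d n z))"
      by (intro summable_suminf_not_top) auto
    then have "summable (\<lambda>n. u (Suc n) z - u n z)"
      unfolding d_def by (rule summable_norm_cancel)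
    then have "convergent (\<lambda>n. \<Sum>i<n. u (Suc i) z - u i z)"
      by (simp add: summable_iff_convergent)
    then have "convergent (\<lambda>n. (\<Sum>i<n. u (Suc i) z - u i z) + u 0 z)"
      by (rule convergent_add) (rule convergent_const)
    moreover have "(\<Sum>i<n. u (Suc i) z - u i z) = u n z - u 0 z" for n
      using sum_lessThan_telescope[of "\<lambda>i. u i z" n] by simp
    ultimately show ?case
      by simp
  qed
qed

text \<open>The Riesz--Fischer argument: a rapidly converging subsequence has a pointwise limit, and Fatou's lemma
  carries the Cauchy estimate over to that limit.\<close>

lemma L2_torus_complete:
  assumes u: "\<And>n. u n \<in> L2_torus"
    and Cauchy: "\<And>e. 0 < e \<Longrightarrow> \<exists>N. \<forall>m\<ge>N. \<forall>n\<ge>N. L2_norm (\<lambda>z. u m z - u n z) < e"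
  shows "\<exists>v\<in>L2_torus. (\<lambda>n. L2_norm (\<lambda>z. u n z - v z)) \<longlonglongrightarrow> 0"
proof -
  note [measurable] = L2_torusD(1)[OF u]
  \<comment> \<open>The indices \<open>r k\<close> increase and exceed all of \<open>N 0, \<dots>, N k\<close>, so consecutive terms of the
    subsequence are within \<open>2\<^sup>-\<^sup>k\<close> of each other.\<close>
  obtain N where N: "\<And>k m n. m \<ge> N k \<Longrightarrow> n \<ge> N k \<Longrightarrow> L2_norm (\<lambda>z. u m z - u n z) < (1 / 2) ^ k"
    using Cauchy[of "(1 / 2) ^ k" for k] by (metis zero_less_power half_gt_zero_iff zero_less_one)
  define r where "r k = k + (\<Sum>i\<le>k. N i)" for k
  have r: "N k \<le> r k" "r k \<le> r (Suc k)" "k \<le> r k" for k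
    using member_le_sum[of k "{..k}" N] by (auto simp: r_def)
  have "AE z in torus_haar. convergent (\<lambda>k. u (r k) z)"
  proof (rule AE_convergent_if_summable_L2[OF u])
    fix k
    have "N k \<le> r k" "N k \<le> r (Suc k)" using r[of k] by auto
    then show "L2_norm (\<lambda>z. u (r (Suc k)) z - u (r k) z) \<le> (1 / 2) ^ k"
      using N[of k "r (Suc k)" "r k"] by auto
  qed
  define v where "v z = lim (\<lambda>k. u (r k) z)" for z
  have [measurable]: "v \<in> borel_measurable torus_haar"
    unfolding v_def by measurable
  have conv: "AE z in torus_haar. (\<lambda>k. u (r k) z) \<longlonglongrightarrow> v z"
    using \<open>AE z in torus_haar. convergent (\<lambda>k. u (r k) z)\<close>
    by eventually_elim (simp add: v_def convergent_LIMSEQ_iff)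
  have bound: "(\<integral>\<^sup>+z. ennreal ((cmod (u n z - v z))\<^sup>2) \<partial>torus_haar) \<le> ennreal (e\<^sup>2)"
    if e: "0 < e" and M: "\<forall>m\<ge>M. \<forall>n\<ge>M. L2_norm (\<lambda>z. u m z - u n z) < e" and n: "n \<ge> M" for n M e
  proof -
    have "(\<integral>\<^sup>+z. ennreal ((cmod (u n z - v z))\<^sup>2) \<partial>torus_haar) =
        (\<integral>\<^sup>+z. liminf (\<lambda>k. ennreal ((cmod (u n z - u (r k) z))\<^sup>2)) \<partial>torus_haar)"
    proof (rule nn_integral_cong_AE)
      show "AE z in torus_haar. ennreal ((cmod (u n z - v z))\<^sup>2) =
          liminf (\<lambda>k. ennreal ((cmod (u n z - u (r k) z))\<^sup>2))"
        using conv
      proof eventually_elim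
        case (elim z)
        then have "(\<lambda>k. ennreal ((cmod (u n z - u (r k) z))\<^sup>2)) \<longlonglongrightarrow> ennreal ((cmod (u n z - v z))\<^sup>2)"
          by (intro tendsto_ennrealI tendsto_intros)
        from lim_imp_Liminf[OF _ this] show ?case by simp
      qed
    qed
    also have "\<dots> \<le> liminf (\<lambda>k. \<integral>\<^sup>+z. ennreal ((cmod (u n z - u (r k) z))\<^sup>2) \<partial>torus_haar)"
      by (rule nn_integral_liminf) simp
    also have "\<dots> \<le> liminf (\<lambda>k. ennreal (e\<^sup>2))"
    proof (rule Liminf_mono)
      have "(\<integral>\<^sup>+z. ennreal ((cmod (u n z - u (r k) z))\<^sup>2) \<partial>torus_haar) \<le> ennreal (e\<^sup>2)" if "k \<ge> M" for k
      proof -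
        have "(\<integral>\<^sup>+z. ennreal ((cmod (u n z - u (r k) z))\<^sup>2) \<partial>torus_haar) =
            ennreal ((L2_norm (\<lambda>z. u n z - u (r k) z))\<^sup>2)"
          unfolding L2_norm_power2
          by (intro nn_integral_eq_integral L2_torusD(2) L2_torus_diff u) auto
        also have "\<dots> \<le> ennreal (e\<^sup>2)"
          using M n that r(3)[of k] by (intro ennreal_leI power_mono) (auto intro: less_imp_le)
        finally show ?thesis .
      qed
      then show "\<forall>\<^sub>F k in sequentially.
          (\<integral>\<^sup>+z. ennreal ((cmod (u n z - u (r k) z))\<^sup>2) \<partial>torus_haar) \<le> ennreal (e\<^sup>2)"
        by (auto simp: eventually_sequentially)
    qed
    finally show ?thesis by (simp add: Liminf_const)
  qed
  have uv: "(\<lambda>z. u n z - v z) \<in> L2_torus" if "\<forall>m\<ge>M. \<forall>n\<ge>M. L2_norm (\<lambda>z. u m z - u n z) < 1" "n \<ge> M" for n M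
    using bound[OF _ that] by (auto simp: L2_torus_def integrable_iff_bounded intro: le_less_trans)
  obtain M where M: "\<forall>m\<ge>M. \<forall>n\<ge>M. L2_norm (\<lambda>z. u m z - u n z) < 1"
    using Cauchy[of 1] by auto
  have v: "v \<in> L2_torus"
    using L2_torus_diff[OF u[of M] uv[OF M, of M]] by simp
  have "(\<lambda>n. L2_norm (\<lambda>z. u n z - v z)) \<longlonglongrightarrow> 0"
  proof (rule LIMSEQ_I)
    fix e :: real assume "0 < e"
    then obtain M where M: "\<forall>m\<ge>M. \<forall>n\<ge>M. L2_norm (\<lambda>z. u m z - u n z) < e / 2"
      using Cauchy[of "e / 2"] by auto
    have "L2_norm (\<lambda>z. u n z - v z) \<le> e / 2" if "n \<ge> M" for n
    proof -
      have "ennreal ((L2_norm (\<lambda>z. u n z - v z))\<^sup>2) \<le> ennreal ((e / 2)\<^sup>2)"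
        using bound[OF _ M that] \<open>0 < e\<close> unfolding L2_norm_power2
        by (subst nn_integral_eq_integral[symmetric]) (auto intro!: L2_torusD(2) L2_torus_diff u v)
      then have "(L2_norm (\<lambda>z. u n z - v z))\<^sup>2 \<le> (e / 2)\<^sup>2"
        by (subst (asm) ennreal_le_iff) auto
      then show ?thesis
        using \<open>0 < e\<close> by (auto intro: power2_le_imp_le)
    qed
    then have "norm (L2_norm (\<lambda>z. u n z - v z) - 0) < e" if "n \<ge> M" for n
      using that \<open>0 < e\<close> by fastforce
    then show "\<exists>M. \<forall>n\<ge>M. norm (L2_norm (\<lambda>z. u n z - v z) - 0) < e"
      by blast
  qed
  with v show ?thesis by blast
qed

section \<open>Characters and Fourier coefficients\<close>

text \<open>On the torus \<open>w powi (- 1) = cnj w\<close>, so negative frequencies are the conjugates of the positive ones.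
  With integer powers a character with nonnegative frequencies is a monomial at all points, not only on the
  torus.\<close>

definition character :: "int \<times> int \<Rightarrow> complex \<times> complex \<Rightarrow> complex" where
  "character \<mu> z = fst z powi fst \<mu> * snd z powi snd \<mu>"

lemma character_add:
  assumes "z \<in> space torus_haar"
  shows "character (\<mu> + \<nu>) z = character \<mu> z * character \<nu> z"
proof -
  have "fst z \<noteq> 0" "snd z \<noteq> 0"
    using assms by (auto simp: space_torus_haar)
  then show ?thesis
    by (simp add: character_def power_int_add)
qed

lemma cmod_character [simp]: "z \<in> space torus_haar \<Longrightarrow> cmod (character \<mu> z) = 1"
  by (auto simp: character_def space_torus_haar norm_mult norm_power_int)

lemma character_uminus:
  assumes "z \<in> space torus_haar"
  shows "character (- \<mu>) z = cnj (character \<mu> z)"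
proof -
  have "inverse w = cnj w" if "cmod w = 1" for w
    using that complex_norm_square[of w] by (intro inverse_unique) (simp add: mult.commute)
  then show ?thesis
    using assms
    by (auto simp: character_def space_torus_haar power_int_minus norm_power_int)
qed

lemma borel_measurable_power_int: "(\<lambda>x::complex. x powi n) \<in> borel_measurable borel"
  unfolding power_int_def by measurable

lemma borel_measurable_character [measurable]: "character \<mu> \<in> borel_measurable torus_haar"
proof -
  have [measurable]: "(\<lambda>x::complex. x powi n) \<in> borel_measurable circle_haar" for n
    by (intro borel_measurable_circle_haar borel_measurable_power_int)
  show ?thesis
    unfolding character_def[abs_def] by measurable
qed

lemma integral_circle_powi:
  "(LINT x|circle_haar. x powi n) = (if n = 0 then 1 else 0)"
proof (cases "n = 0")
  case True
  then show ?thesis by (simp add: circle.prob_space)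
next
  case False
  let ?U = "uniform_measure lborel {0..1::real}"
  let ?F = "\<lambda>t::real. cis (2 * pi * n * t) / (2 * pi * n * \<i>)"
  have [measurable]: "(\<lambda>t. cis (2 * pi * t)) \<in> borel_measurable borel"
    by (intro borel_measurable_continuous_onI continuous_intros)
  then have meas: "(\<lambda>t. cis (2 * pi * t)) \<in> measurable ?U (restrict_space borel (sphere 0 1))"
    by (intro measurable_restrict_space2) auto
  have "(LINT x|circle_haar. x powi n) = (LINT t|?U. cis (2 * pi * t) powi n)"
    unfolding circle_haar_def
    by (rule integral_distr[OF meas])
       (intro measurable_restrict_space1 borel_measurable_power_int)
  also have "\<dots> = (LINT t|?U. cis (2 * pi * n * t))"
    by (simp add: cis_power_int mult_ac)
  also have "\<dots> = (LINT t|lborel. indicator {0..1} t *\<^sub>R cis (2 * pi * n * t))"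
  proof -
    have "?U = density lborel (\<lambda>t. ennreal (indicator {0..1} t))"
      unfolding uniform_measure_def by (rule density_cong) (auto split: split_indicator)
    then show ?thesis
      by (simp only:) (rule integral_density,
        auto intro!: borel_measurable_continuous_onI continuous_intros)
  qed
  also have "\<dots> = ?F 1 - ?F 0"
  proof (rule integral_FTC_Icc)
    fix t :: real
    show "(?F has_vector_derivative cis (2 * pi * n * t)) (at t within {0..1})"
    proof -
      have "((\<lambda>w. exp (2 * pi * n * \<i> * w) / (2 * pi * n * \<i>)) has_field_derivative
          exp (2 * pi * n * \<i> * of_real t)) (at (of_real t))"
        using False by (auto intro!: derivative_eq_intros)
      then have "((\<lambda>t. exp (2 * pi * n * \<i> * of_real t) / (2 * pi * n * \<i>)) has_vector_derivative
          exp (2 * pi * n * \<i> * of_real t)) (at t within {0..1})"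
        by (rule has_vector_derivative_real_field)
      then show ?thesis by (simp add: cis_conv_exp mult_ac)
    qed
  qed (auto intro!: continuous_intros)
  also have "cis (2 * pi * real_of_int n * 1) = 1"
    using cis_multiple_2pi[of "of_int n"] by (simp add: mult_ac)
  finally show ?thesis using False by simp
qed

lemma Linf_character: "character \<mu> \<in> Linf_torus"
  unfolding Linf_torus_def by (auto intro!: exI[of _ 1] AE_I2)

lemma L2_character: "character \<mu> \<in> L2_torus"
  by (rule L2_torusI_le[where g = "\<lambda>_. 1"]) (auto intro!: AE_I2)

lemma L2_norm_character: "L2_norm (character \<mu>) = 1"
proof -
  have "(LINT z|torus_haar. (cmod (character \<mu> z))\<^sup>2) = (LINT z|torus_haar. 1)"
    by (rule Bochner_Integration.integral_cong) simp_all
  then show ?thesis by (simp add: L2_norm_def torus.prob_space)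
qed

lemma integral_character: "(LINT z|torus_haar. character \<mu> z) = (if \<mu> = 0 then 1 else 0)"
proof -
  have "(LINT z|torus_haar. character \<mu> z) =
      (LINT x|circle_haar. LINT y|circle_haar. character \<mu> (x, y))"
    using L1_le_L2_norm(1)[OF L2_character] unfolding torus_haar_def
    by (rule torus_pair.integral_fst'[symmetric])
  also have "\<dots> = (if \<mu> = 0 then 1 else 0)"
    by (simp add: character_def integral_circle_powi prod_eq_iff)
  finally show ?thesis .
qed

lemma L2_inner_character: "L2_inner (character \<mu>) (character \<nu>) = (if \<mu> = \<nu> then 1 else 0)"
proof -
  have "L2_inner (character \<mu>) (character \<nu>) = (LINT z|torus_haar. character (\<mu> - \<nu>) z)"
    unfolding L2_inner_def
    by (rule Bochner_Integration.integral_cong)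
       (simp_all add: character_add[of _ \<mu> "- \<nu>", simplified] character_uminus)
  then show ?thesis by (simp add: integral_character)
qed

definition coef :: "(complex \<times> complex \<Rightarrow> complex) \<Rightarrow> int \<times> int \<Rightarrow> complex" where
  "coef f \<mu> = L2_inner f (character \<mu>)"

lemma coef_diff: "f \<in> L2_torus \<Longrightarrow> g \<in> L2_torus \<Longrightarrow> coef (\<lambda>z. f z - g z) \<mu> = coef f \<mu> - coef g \<mu>"
  by (simp add: coef_def L2_inner_diff_left L2_character)

lemma coef_character: "coef (character \<nu>) \<mu> = (if \<nu> = \<mu> then 1 else 0)"
  by (simp add: coef_def L2_inner_character)

lemma coef_cnj: "coef (\<lambda>z. cnj (f z)) \<mu> = cnj (coef f (- \<mu>))"
proof -
  have "coef (\<lambda>z. cnj (f z)) \<mu> = (LINT z|torus_haar. cnj (f z * cnj (character (- \<mu>) z)))"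
    unfolding coef_def L2_inner_def
    by (rule Bochner_Integration.integral_cong) (simp_all add: character_uminus)
  also have "\<dots> = cnj (coef f (- \<mu>))"
    unfolding coef_def L2_inner_def by (rule Bochner_Integration.integral_cnj)
  finally show ?thesis .
qed

lemma coef_mult_character: "coef (\<lambda>z. f z * character \<nu> z) \<mu> = coef f (\<mu> - \<nu>)"
  unfolding coef_def L2_inner_def
proof (rule Bochner_Integration.integral_cong)
  fix z assume z: "z \<in> space torus_haar"
  have "character (\<mu> - \<nu>) z = character \<mu> z * cnj (character \<nu> z)"
    using character_add[OF z, of \<mu> "- \<nu>"] by (simp add: character_uminus z)
  then show "f z * character \<nu> z * cnj (character \<mu> z) = f z * cnj (character (\<mu> - \<nu>) z)"
    by simp
qed simp

lemma coef_cong_AE: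
  assumes "f \<in> L2_torus" "g \<in> L2_torus" "AE z in torus_haar. f z = g z"
  shows "coef f \<mu> = coef g \<mu>"
  unfolding coef_def by (intro L2_inner_cong_AE assms L2_character)

definition trig_sum :: "(int \<times> int \<Rightarrow> complex) \<Rightarrow> (int \<times> int) set \<Rightarrow> complex \<times> complex \<Rightarrow> complex" where
  "trig_sum c F z = (\<Sum>\<mu>\<in>F. c \<mu> * character \<mu> z)"

lemma L2_trig_sum: "trig_sum c F \<in> L2_torus"
  unfolding trig_sum_def[abs_def] by (intro L2_torus_sum L2_torus_cmult L2_character)

lemma L2_inner_trig_sum_left:
  "h \<in> L2_torus \<Longrightarrow> L2_inner (trig_sum c F) h = (\<Sum>\<mu>\<in>F. c \<mu> * cnj (coef h \<mu>))"
  unfolding trig_sum_def[abs_def]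
  by (simp add: L2_inner_sum_left L2_torus_cmult L2_character L2_inner_cmult_left coef_def
      L2_inner_commute[of "character _" h])

lemma L2_inner_trig_sum_right:
  "h \<in> L2_torus \<Longrightarrow> L2_inner h (trig_sum c F) = (\<Sum>\<mu>\<in>F. cnj (c \<mu>) * coef h \<mu>)"
  by (subst L2_inner_commute) (simp add: L2_inner_trig_sum_left)

lemma coef_trig_sum: "finite F \<Longrightarrow> coef (trig_sum c F) \<mu> = (if \<mu> \<in> F then c \<mu> else 0)"
proof -
  assume F: "finite F"
  have "coef (trig_sum c F) \<mu> = (\<Sum>\<nu>\<in>F. c \<nu> * cnj (coef (character \<mu>) \<nu>))"
    unfolding coef_def[of "trig_sum c F"] by (rule L2_inner_trig_sum_left[OF L2_character])
  also have "\<dots> = (\<Sum>\<nu>\<in>F. if \<mu> = \<nu> then c \<nu> else 0)"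
    by (rule sum.cong) (simp_all add: coef_character)
  also have "\<dots> = (if \<mu> \<in> F then c \<mu> else 0)"
    using F by simp
  finally show ?thesis .
qed

lemma L2_norm_trig_sum: "finite F \<Longrightarrow> (L2_norm (trig_sum c F))\<^sup>2 = (\<Sum>\<mu>\<in>F. (cmod (c \<mu>))\<^sup>2)"
proof -
  assume F: "finite F"
  have "complex_of_real ((L2_norm (trig_sum c F))\<^sup>2) = of_real (\<Sum>\<mu>\<in>F. (cmod (c \<mu>))\<^sup>2)"
    unfolding L2_inner_self[symmetric]
    by (simp add: L2_inner_trig_sum_left L2_trig_sum coef_trig_sum F complex_norm_square del: of_real_power)
  then show ?thesis by (simp only: of_real_eq_iff)
qed

lemma trig_sum_add: "trig_sum c F z + trig_sum d F z = trig_sum (\<lambda>\<mu>. c \<mu> + d \<mu>) F z"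
  by (simp add: trig_sum_def sum.distrib distrib_right)

lemma trig_sum_diff: "trig_sum c F z - trig_sum d F z = trig_sum (\<lambda>\<mu>. c \<mu> - d \<mu>) F z"
  by (simp add: trig_sum_def sum_subtractf left_diff_distrib)

lemma trig_sum_cmult: "k * trig_sum c F z = trig_sum (\<lambda>\<mu>. k * c \<mu>) F z"
  by (simp add: trig_sum_def sum_distrib_left mult.assoc)

lemma trig_sum_mono_neutral:
  assumes "finite G" "F \<subseteq> G"
  shows "trig_sum c F z = trig_sum (\<lambda>\<mu>. if \<mu> \<in> F then c \<mu> else 0) G z"
  unfolding trig_sum_def using assms by (intro sum.mono_neutral_cong_left) auto

lemma fourier_sum_orthogonal:
  assumes f: "f \<in> L2_torus" and F: "finite F"
  shows "L2_inner (\<lambda>z. f z - trig_sum (coef f) F z) (trig_sum c F) = 0"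
  by (simp add: L2_inner_diff_left f L2_trig_sum L2_inner_trig_sum_right coef_trig_sum F)

text \<open>Pythagoras: the Fourier sum over \<open>F\<close> is the orthogonal projection of \<open>f\<close> onto the span of the
  characters in \<open>F\<close>. Its best approximation property and Bessel's inequality follow.\<close>

lemma L2_norm_diff_trig_sum:
  assumes f: "f \<in> L2_torus" and F: "finite F"
  shows "(L2_norm (\<lambda>z. f z - trig_sum c F z))\<^sup>2 =
    (L2_norm (\<lambda>z. f z - trig_sum (coef f) F z))\<^sup>2 + (\<Sum>\<mu>\<in>F. (cmod (coef f \<mu> - c \<mu>))\<^sup>2)"
proof -
  have "(\<lambda>z. f z - trig_sum c F z) =
      (\<lambda>z. (f z - trig_sum (coef f) F z) + trig_sum (\<lambda>\<mu>. coef f \<mu> - c \<mu>) F z)"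
    by (simp add: trig_sum_diff[symmetric])
  then show ?thesis
    by (simp only: L2_norm_add_power2 L2_torus_diff f L2_trig_sum fourier_sum_orthogonal F
        L2_norm_trig_sum zero_complex.sel mult_zero_right add_0_right)
qed

lemma L2_norm_diff_fourier_sum_le:
  assumes "f \<in> L2_torus" "finite G" "F \<subseteq> G"
  shows "L2_norm (\<lambda>z. f z - trig_sum (coef f) G z) \<le> L2_norm (\<lambda>z. f z - trig_sum c F z)"
proof (rule power2_le_imp_le)
  show "(L2_norm (\<lambda>z. f z - trig_sum (coef f) G z))\<^sup>2 \<le> (L2_norm (\<lambda>z. f z - trig_sum c F z))\<^sup>2"
    unfolding trig_sum_mono_neutral[OF assms(2,3), of c]
    by (subst L2_norm_diff_trig_sum[OF assms(1,2)]) (simp add: sum_nonneg)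
qed simp

lemma bessel:
  assumes "f \<in> L2_torus" "finite F"
  shows "(\<Sum>\<mu>\<in>F. (cmod (coef f \<mu>))\<^sup>2) \<le> (L2_norm f)\<^sup>2"
  using L2_norm_diff_trig_sum[OF assms, of "\<lambda>_. 0"] by (simp add: trig_sum_def)

section \<open>Closed spans of characters\<close>

text \<open>The functions that are \<open>L\<^sup>2\<close> limits of trigonometric polynomials with frequencies in \<open>A\<close>. Both
  Hardy spaces have this form, and inside such a space Parseval's identity holds by construction.\<close>

definition closed_span :: "(int \<times> int) set \<Rightarrow> (complex \<times> complex \<Rightarrow> complex) set" where
  "closed_span A = {f \<in> L2_torus. \<forall>e>0. \<exists>F c. finite F \<and> F \<subseteq> A \<and> L2_norm (\<lambda>z. f z - trig_sum c F z) < e}"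

lemma closed_span_L2: "f \<in> closed_span A \<Longrightarrow> f \<in> L2_torus"
  by (simp add: closed_span_def)

lemma closed_spanE:
  assumes "f \<in> closed_span A" "0 < e"
  obtains F c where "finite F" "F \<subseteq> A" "L2_norm (\<lambda>z. f z - trig_sum c F z) < e"
  using assms by (auto simp: closed_span_def)

lemma closed_spanI:
  assumes "f \<in> L2_torus"
    and "\<And>e. 0 < e \<Longrightarrow> \<exists>F c. finite F \<and> F \<subseteq> A \<and> L2_norm (\<lambda>z. f z - trig_sum c F z) < e"
  shows "f \<in> closed_span A"
  using assms by (simp add: closed_span_def)

lemma closed_span_mono: "A \<subseteq> B \<Longrightarrow> closed_span A \<subseteq> closed_span B"
  unfolding closed_span_def by (rule Collect_mono) (meson subset_trans)

lemma fourier_sums_tendsto: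
  assumes f: "f \<in> closed_span A"
  shows "((\<lambda>F. L2_norm (\<lambda>z. f z - trig_sum (coef f) F z)) \<longlongrightarrow> 0) (finite_subsets_at_top A)"
proof (rule tendstoI)
  fix e :: real assume "0 < e"
  with f obtain F0 c where F0: "finite F0" "F0 \<subseteq> A" "L2_norm (\<lambda>z. f z - trig_sum c F0 z) < e"
    by (auto simp: closed_span_def)
  have "L2_norm (\<lambda>z. f z - trig_sum (coef f) F z) < e" if "finite F" "F0 \<subseteq> F" for F
    using L2_norm_diff_fourier_sum_le[OF closed_span_L2[OF f] that, of c] F0(3) by linarith
  with F0 show "\<forall>\<^sub>F F in finite_subsets_at_top A. dist (L2_norm (\<lambda>z. f z - trig_sum (coef f) F z)) 0 < e"
    unfolding eventually_finite_subsets_at_top by (intro exI[of _ F0]) (auto simp: dist_real_def)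
qed

text \<open>The Fourier sums of \<open>f\<close> converge to \<open>f\<close> along the finite subsets of \<open>A\<close>, and the inner product with
  \<open>g\<close> is continuous.\<close>

lemma parseval:
  assumes f: "f \<in> closed_span A" and g: "g \<in> L2_torus"
  shows "((\<lambda>\<mu>. coef f \<mu> * cnj (coef g \<mu>)) has_sum L2_inner f g) A"
proof -
  note L2 = closed_span_L2[OF f]
  have "((\<lambda>F. L2_inner f g - (\<Sum>\<mu>\<in>F. coef f \<mu> * cnj (coef g \<mu>))) \<longlongrightarrow> 0) (finite_subsets_at_top A)"
  proof (rule Lim_null_comparison)
    show "\<forall>\<^sub>F F in finite_subsets_at_top A.
        norm (L2_inner f g - (\<Sum>\<mu>\<in>F. coef f \<mu> * cnj (coef g \<mu>))) \<le>
        L2_norm (\<lambda>z. f z - trig_sum (coef f) F z) * L2_norm g"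
    proof (rule always_eventually, rule allI)
      fix F
      have "L2_inner f g - (\<Sum>\<mu>\<in>F. coef f \<mu> * cnj (coef g \<mu>)) =
          L2_inner (\<lambda>z. f z - trig_sum (coef f) F z) g"
        by (simp add: L2_inner_diff_left L2 L2_trig_sum g L2_inner_trig_sum_left)
      then show "norm (L2_inner f g - (\<Sum>\<mu>\<in>F. coef f \<mu> * cnj (coef g \<mu>))) \<le>
          L2_norm (\<lambda>z. f z - trig_sum (coef f) F z) * L2_norm g"
        using L2_Cauchy_Schwarz[OF L2_torus_diff[OF L2 L2_trig_sum] g] by simp
    qed
    show "((\<lambda>F. L2_norm (\<lambda>z. f z - trig_sum (coef f) F z) * L2_norm g) \<longlongrightarrow> 0)
        (finite_subsets_at_top A)"
      by (rule tendsto_mult_left_zero[OF fourier_sums_tendsto[OF f]])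
  qed
  from tendsto_diff[OF tendsto_const[of "L2_inner f g"] this] show ?thesis
    by (simp add: has_sum_def)
qed

lemma coef_closed_span_off:
  assumes f: "f \<in> closed_span A" and \<mu>: "\<mu> \<notin> A"
  shows "coef f \<mu> = 0"
proof -
  have "((\<lambda>\<nu>. coef f \<nu> * cnj (coef (character \<mu>) \<nu>)) has_sum coef f \<mu>) A"
    unfolding coef_def[of f \<mu>] by (rule parseval[OF f L2_character])
  moreover have "((\<lambda>\<nu>. coef f \<nu> * cnj (coef (character \<mu>) \<nu>)) has_sum 0) A"
    using \<mu> by (intro has_sum_0) (auto simp: coef_character)
  ultimately show ?thesis by (rule has_sum_unique)
qed

lemma closed_span_orthogonal:
  assumes f: "f \<in> closed_span A" and g: "g \<in> L2_torus"
    and zero: "\<And>\<mu>. \<mu> \<in> A \<Longrightarrow> coef f \<mu> = 0 \<or> coef g \<mu> = 0"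
  shows "L2_inner f g = 0"
proof (rule has_sum_unique[OF parseval[OF f g]])
  show "((\<lambda>\<mu>. coef f \<mu> * cnj (coef g \<mu>)) has_sum 0) A"
    using zero by (intro has_sum_0) auto
qed

lemma closed_span_add:
  assumes "f \<in> closed_span A" "g \<in> closed_span A"
  shows "(\<lambda>z. f z + g z) \<in> closed_span A"
proof (rule closed_spanI)
  note L2 = assms[THEN closed_span_L2]
  show "(\<lambda>z. f z + g z) \<in> L2_torus"
    using L2 by (rule L2_torus_add)
  fix e :: real assume "0 < e"
  then have "0 < e / 2" by simp
  from closed_spanE[OF assms(1) this] obtain F c where
    F: "finite F" "F \<subseteq> A" "L2_norm (\<lambda>z. f z - trig_sum c F z) < e / 2" .
  from closed_spanE[OF assms(2) \<open>0 < e / 2\<close>] obtain G d where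
    G: "finite G" "G \<subseteq> A" "L2_norm (\<lambda>z. g z - trig_sum d G z) < e / 2" .
  have fin: "finite (F \<union> G)" using F G by simp
  have F': "L2_norm (\<lambda>z. f z - trig_sum (coef f) (F \<union> G) z) < e / 2"
    using L2_norm_diff_fourier_sum_le[OF L2(1) fin, of F c] F(3) by simp
  have G': "L2_norm (\<lambda>z. g z - trig_sum (coef g) (F \<union> G) z) < e / 2"
    using L2_norm_diff_fourier_sum_le[OF L2(2) fin, of G d] G(3) by simp
  have "(\<lambda>z. f z + g z - trig_sum (\<lambda>\<mu>. coef f \<mu> + coef g \<mu>) (F \<union> G) z) =
      (\<lambda>z. (f z - trig_sum (coef f) (F \<union> G) z) + (g z - trig_sum (coef g) (F \<union> G) z))"
    by (simp add: trig_sum_add[symmetric] algebra_simps)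
  then have "L2_norm (\<lambda>z. f z + g z - trig_sum (\<lambda>\<mu>. coef f \<mu> + coef g \<mu>) (F \<union> G) z) \<le>
      L2_norm (\<lambda>z. f z - trig_sum (coef f) (F \<union> G) z) + L2_norm (\<lambda>z. g z - trig_sum (coef g) (F \<union> G) z)"
    using L2_norm_triangle[of "\<lambda>z. f z - trig_sum (coef f) (F \<union> G) z" "\<lambda>z. g z - trig_sum (coef g) (F \<union> G) z"]
    by (simp add: L2 L2_trig_sum L2_torus_diff)
  with F' G' have "L2_norm (\<lambda>z. f z + g z - trig_sum (\<lambda>\<mu>. coef f \<mu> + coef g \<mu>) (F \<union> G) z) < e"
    by linarith
  with fin F(2) G(2) show "\<exists>F c. finite F \<and> F \<subseteq> A \<and> L2_norm (\<lambda>z. f z + g z - trig_sum c F z) < e"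
    by (intro exI[of _ "F \<union> G"] exI conjI) auto
qed

lemma closed_span_cmult:
  assumes "f \<in> closed_span A"
  shows "(\<lambda>z. k * f z) \<in> closed_span A"
proof (cases "k = 0")
  case True
  then have "L2_norm (\<lambda>z. k * f z - trig_sum (\<lambda>_. 0) {} z) = 0"
    by (simp add: trig_sum_def L2_norm_def)
  then show ?thesis
    using L2_torus_cmult[OF closed_span_L2[OF assms], of k]
    by (intro closed_spanI exI[of _ "{}"] exI[of _ "\<lambda>_. 0"]) simp_all
next
  case False
  show ?thesis
  proof (rule closed_spanI)
    show "(\<lambda>z. k * f z) \<in> L2_torus"
      using assms by (intro L2_torus_cmult closed_span_L2)
    fix e :: real assume "0 < e"
    with False have "0 < e / cmod k" by simp
    from closed_spanE[OF assms this] obtain F c where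
      F: "finite F" "F \<subseteq> A" "L2_norm (\<lambda>z. f z - trig_sum c F z) < e / cmod k" .
    have "L2_norm (\<lambda>z. k * f z - trig_sum (\<lambda>\<mu>. k * c \<mu>) F z) = cmod k * L2_norm (\<lambda>z. f z - trig_sum c F z)"
      by (simp add: trig_sum_cmult[symmetric] right_diff_distrib[symmetric] L2_norm_cmult)
    also have "\<dots> < e"
      using F(3) False by (simp add: field_simps)
    finally show "\<exists>F c. finite F \<and> F \<subseteq> A \<and> L2_norm (\<lambda>z. k * f z - trig_sum c F z) < e"
      using F(1,2) by (intro exI[of _ F] exI conjI) auto
  qed
qed

lemma closed_span_diff:
  assumes "f \<in> closed_span A" "g \<in> closed_span A"
  shows "(\<lambda>z. f z - g z) \<in> closed_span A"
  using closed_span_add[OF assms(1) closed_span_cmult[OF assms(2), of "-1"]] by simp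

lemma trig_sum_in_closed_span:
  assumes "finite F" "F \<subseteq> A"
  shows "trig_sum c F \<in> closed_span A"
proof -
  have "L2_norm (\<lambda>z. trig_sum c F z - trig_sum c F z) = 0"
    by (simp add: L2_norm_def)
  with assms show ?thesis
    by (intro closed_spanI L2_trig_sum exI[of _ F] exI[of _ c]) simp
qed

lemma character_in_closed_span:
  assumes "\<mu> \<in> A"
  shows "character \<mu> \<in> closed_span A"
  using trig_sum_in_closed_span[of "{\<mu>}" A "\<lambda>_. 1"] assms by (simp add: trig_sum_def[abs_def])

lemma closed_span_cnj:
  assumes "f \<in> closed_span A"
  shows "(\<lambda>z. cnj (f z)) \<in> closed_span (uminus ` A)"
proof (rule closed_spanI)
  show "(\<lambda>z. cnj (f z)) \<in> L2_torus"
    using assms by (intro L2_torus_cnj closed_span_L2)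
  fix e :: real assume "0 < e"
  from closed_spanE[OF assms this] obtain F c where
    F: "finite F" "F \<subseteq> A" "L2_norm (\<lambda>z. f z - trig_sum c F z) < e" .
  have "cnj (trig_sum c F z) = trig_sum (\<lambda>\<mu>. cnj (c (- \<mu>))) (uminus ` F) z" if "z \<in> space torus_haar" for z
    unfolding trig_sum_def by (subst sum.reindex) (auto simp: character_uminus that)
  then have "L2_norm (\<lambda>z. cnj (f z) - trig_sum (\<lambda>\<mu>. cnj (c (- \<mu>))) (uminus ` F) z) =
      L2_norm (\<lambda>z. cnj (f z - trig_sum c F z))"
    by (intro L2_norm_cong) simp
  also have "\<dots> < e"
    unfolding L2_norm_cnj by (rule F(3))
  finally show "\<exists>F c. finite F \<and> F \<subseteq> uminus ` A \<and> L2_norm (\<lambda>z. cnj (f z) - trig_sum c F z) < e"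
    using F(1,2) by (intro exI[of _ "uminus ` F"] exI conjI) auto
qed

lemma closed_span_mult_character:
  assumes "f \<in> closed_span A"
  shows "(\<lambda>z. f z * character \<nu> z) \<in> closed_span ((\<lambda>\<mu>. \<mu> + \<nu>) ` A)"
proof (rule closed_spanI)
  show "(\<lambda>z. f z * character \<nu> z) \<in> L2_torus"
    using L2_torus_Linf_mult[OF Linf_character closed_span_L2[OF assms], of \<nu>] by (simp add: mult.commute)
  fix e :: real assume "0 < e"
  from closed_spanE[OF assms this] obtain F c where
    F: "finite F" "F \<subseteq> A" "L2_norm (\<lambda>z. f z - trig_sum c F z) < e" .
  let ?p = "trig_sum (\<lambda>\<mu>. c (\<mu> - \<nu>)) ((\<lambda>\<mu>. \<mu> + \<nu>) ` F)"
  have p: "?p z = trig_sum c F z * character \<nu> z" if "z \<in> space torus_haar" for z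
    unfolding trig_sum_def
    by (subst sum.reindex) (auto simp: inj_on_def character_add that sum_distrib_right mult.assoc intro!: sum.cong)
  have "L2_norm (\<lambda>z. f z * character \<nu> z - ?p z) = L2_norm (\<lambda>z. f z - trig_sum c F z)"
    unfolding L2_norm_def
  proof (rule arg_cong[of _ _ sqrt], rule Bochner_Integration.integral_cong)
    fix z assume z: "z \<in> space torus_haar"
    have "f z * character \<nu> z - ?p z = (f z - trig_sum c F z) * character \<nu> z"
      by (simp add: p z left_diff_distrib)
    then show "(cmod (f z * character \<nu> z - ?p z))\<^sup>2 = (cmod (f z - trig_sum c F z))\<^sup>2"
      by (simp add: norm_mult z)
  qed simp
  also note F(3)
  finally show "\<exists>F c. finite F \<and> F \<subseteq> (\<lambda>\<mu>. \<mu> + \<nu>) ` A \<and> L2_norm (\<lambda>z. f z * character \<nu> z - trig_sum c F z) < e"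
    using F(1,2) by (intro exI[of _ "(\<lambda>\<mu>. \<mu> + \<nu>) ` F"] exI conjI) auto
qed

text \<open>The Fourier sums approximate at least as well as any other trigonometric polynomial, and they do not
  see the frequencies where the coefficients vanish.\<close>

lemma closed_span_restrict:
  assumes f: "f \<in> closed_span A" and zero: "\<And>\<mu>. \<mu> \<in> A \<Longrightarrow> \<mu> \<notin> B \<Longrightarrow> coef f \<mu> = 0"
  shows "f \<in> closed_span B"
proof (rule closed_spanI)
  show L2: "f \<in> L2_torus" using f by (rule closed_span_L2)
  fix e :: real assume "0 < e"
  from closed_spanE[OF f this] obtain F c where
    F: "finite F" "F \<subseteq> A" "L2_norm (\<lambda>z. f z - trig_sum c F z) < e" .
  have "trig_sum (coef f) (F \<inter> B) = trig_sum (coef f) F"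
    unfolding trig_sum_def[abs_def] using F zero by (intro ext sum.mono_neutral_left) auto
  then have "L2_norm (\<lambda>z. f z - trig_sum (coef f) (F \<inter> B) z) < e"
    using L2_norm_diff_fourier_sum_le[OF L2 F(1) order_refl, of c] F(3) by simp
  with F(1) show "\<exists>F c. finite F \<and> F \<subseteq> B \<and> L2_norm (\<lambda>z. f z - trig_sum c F z) < e"
    by (intro exI[of _ "F \<inter> B"] exI conjI) auto
qed

lemma closed_span_eqI:
  assumes f: "f \<in> closed_span A" and g: "g \<in> closed_span A"
    and eq: "\<And>\<mu>. \<mu> \<in> A \<Longrightarrow> coef f \<mu> = coef g \<mu>"
  shows "AE z in torus_haar. f z = g z"
proof -
  note L2 = closed_span_L2[OF f] closed_span_L2[OF g]
  have fg: "(\<lambda>z. f z - g z) \<in> closed_span A" "(\<lambda>z. f z - g z) \<in> L2_torus"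
    using closed_span_diff[OF f g] L2_torus_diff[OF L2] by auto
  have "L2_inner (\<lambda>z. f z - g z) (\<lambda>z. f z - g z) = 0"
    by (rule closed_span_orthogonal[OF fg]) (simp add: coef_diff L2 eq)
  then have "L2_norm (\<lambda>z. f z - g z) = 0"
    by (simp add: L2_inner_self)
  then show ?thesis
    by (simp add: L2_norm_eq_0_iff fg)
qed

text \<open>By Bessel's inequality the Fourier sums of \<open>u\<close> over growing boxes of frequencies in \<open>A\<close> form a Cauchy
  sequence.\<close>

lemma closed_span_exists_coef:
  assumes u: "u \<in> L2_torus"
  shows "\<exists>p\<in>closed_span A. \<forall>\<mu>\<in>A. coef p \<mu> = coef u \<mu>"
proof -
  define F where "F n = A \<inter> ({- int n..int n} \<times> {- int n..int n})" for n
  define S where "S n = trig_sum (coef u) (F n)" for n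
  define B where "B n = (\<Sum>\<mu>\<in>F n. (cmod (coef u \<mu>))\<^sup>2)" for n
  have fin: "finite (F n)" and F_mono: "m \<le> n \<Longrightarrow> F m \<subseteq> F n" for m n
    by (auto simp: F_def)
  have S: "S n \<in> L2_torus" for n
    unfolding S_def by (rule L2_trig_sum)
  have diff: "(L2_norm (\<lambda>z. S n z - S m z))\<^sup>2 = \<bar>B n - B m\<bar>" if "m \<le> n" for m n
  proof -
    have "S n z - S m z = trig_sum (coef u) (F n - F m) z" for z
      using sum_diff[OF fin F_mono[OF that], of "\<lambda>\<mu>. coef u \<mu> * character \<mu> z"]
      by (simp add: S_def trig_sum_def)
    then have "(L2_norm (\<lambda>z. S n z - S m z))\<^sup>2 = (\<Sum>\<mu>\<in>F n - F m. (cmod (coef u \<mu>))\<^sup>2)"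
      using L2_norm_trig_sum[of "F n - F m" "coef u"] fin by simp
    also have "\<dots> = B n - B m"
      unfolding B_def by (rule sum_diff[OF fin F_mono[OF that]])
    finally show ?thesis
      using zero_le_power2[of "L2_norm (\<lambda>z. S n z - S m z)"] by linarith
  qed
  have diff': "(L2_norm (\<lambda>z. S m z - S n z))\<^sup>2 = \<bar>B m - B n\<bar>" for m n
  proof (cases "m \<le> n")
    case True
    then show ?thesis
      unfolding L2_norm_diff_commute[of "S m" "S n"] abs_minus_commute[of "B m"] by (rule diff)
  next
    case False
    then show ?thesis by (intro diff) simp
  qed
  have "incseq B"
    unfolding B_def by (intro monoI sum_mono2 fin F_mono) auto
  moreover have "B n \<le> (L2_norm u)\<^sup>2" for n
    unfolding B_def by (rule bessel[OF u fin])
  ultimately obtain l where "B \<longlonglongrightarrow> l"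
    using incseq_convergent by blast
  then have "Cauchy B"
    by (rule LIMSEQ_imp_Cauchy)
  have "\<exists>N. \<forall>m\<ge>N. \<forall>n\<ge>N. L2_norm (\<lambda>z. S m z - S n z) < e" if "0 < e" for e
  proof -
    from \<open>0 < e\<close> have "0 < e\<^sup>2" by simp
    from CauchyD[OF \<open>Cauchy B\<close> this] obtain N where
      N: "\<And>m n. m \<ge> N \<Longrightarrow> n \<ge> N \<Longrightarrow> \<bar>B m - B n\<bar> < e\<^sup>2"
      by (auto simp: real_norm_def)
    have "L2_norm (\<lambda>z. S m z - S n z) < e" if "m \<ge> N" "n \<ge> N" for m n
    proof (rule power2_less_imp_less)
      show "(L2_norm (\<lambda>z. S m z - S n z))\<^sup>2 < e\<^sup>2"
        unfolding diff' by (rule N[OF that])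
    qed (use \<open>0 < e\<close> in simp)
    then show ?thesis by (intro exI[of _ N] allI impI)
  qed
  from L2_torus_complete[OF S this] obtain p where
    p: "p \<in> L2_torus" "(\<lambda>n. L2_norm (\<lambda>z. S n z - p z)) \<longlonglongrightarrow> 0" by blast
  have "p \<in> closed_span A"
  proof (rule closed_spanI[OF p(1)])
    fix e :: real assume "0 < e"
    from LIMSEQ_D[OF p(2) this] obtain n where "L2_norm (\<lambda>z. S n z - p z) < e"
      by auto
    then have "L2_norm (\<lambda>z. p z - trig_sum (coef u) (F n) z) < e"
      unfolding S_def L2_norm_diff_commute[of "trig_sum (coef u) (F n)"] .
    with fin show "\<exists>F c. finite F \<and> F \<subseteq> A \<and> L2_norm (\<lambda>z. p z - trig_sum c F z) < e"
      by (intro exI[of _ "F n"] exI[of _ "coef u"] conjI) (auto simp: F_def)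
  qed
  moreover have "coef p \<mu> = coef u \<mu>" if "\<mu> \<in> A" for \<mu>
  proof -
    have "(\<lambda>n. coef (S n) \<mu> - coef p \<mu>) \<longlonglongrightarrow> 0"
    proof (rule Lim_null_comparison[OF _ p(2)], rule always_eventually, rule allI)
      fix n
      have "coef (S n) \<mu> - coef p \<mu> = L2_inner (\<lambda>z. S n z - p z) (character \<mu>)"
        by (simp add: coef_def L2_inner_diff_left S p(1) L2_character)
      then show "norm (coef (S n) \<mu> - coef p \<mu>) \<le> L2_norm (\<lambda>z. S n z - p z)"
        using L2_Cauchy_Schwarz[OF L2_torus_diff[OF S p(1)] L2_character, of n \<mu>] by (simp add: L2_norm_character)
    qed
    moreover have "eventually (\<lambda>n. coef (S n) \<mu> - coef p \<mu> = coef u \<mu> - coef p \<mu>) sequentially"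
    proof (rule eventually_sequentiallyI)
      fix n assume "n \<ge> nat (max \<bar>fst \<mu>\<bar> \<bar>snd \<mu>\<bar>)"
      then have "\<mu> \<in> F n"
        using \<open>\<mu> \<in> A\<close> by (cases \<mu>) (auto simp: F_def)
      then show "coef (S n) \<mu> - coef p \<mu> = coef u \<mu> - coef p \<mu>"
        by (simp add: S_def coef_trig_sum fin)
    qed
    ultimately have "(\<lambda>n. coef u \<mu> - coef p \<mu>) \<longlonglongrightarrow> 0"
      by (rule Lim_transform_eventually)
    then show ?thesis by (simp add: LIMSEQ_const_iff)
  qed
  ultimately show ?thesis by blast
qed

text \<open>The choice in \<open>orth_proj\<close> is from a nonempty set, since the limit of the Fourier sums over \<open>A\<close> is a
  projection. Testing against characters shows that every choice has the same coefficients.\<close>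

lemma orth_proj_closed_span:
  assumes u: "u \<in> L2_torus"
  shows "orth_proj (closed_span A) u \<in> closed_span A"
    and "coef (orth_proj (closed_span A) u) \<mu> = (if \<mu> \<in> A then coef u \<mu> else 0)"
proof -
  let ?P = "\<lambda>p. p \<in> closed_span A \<and> (\<forall>h\<in>closed_span A. L2_inner (\<lambda>z. u z - p z) h = 0)"
  obtain p where p: "p \<in> closed_span A" "\<forall>\<mu>\<in>A. coef p \<mu> = coef u \<mu>"
    using closed_span_exists_coef[OF u] by blast
  have "L2_inner (\<lambda>z. u z - p z) h = 0" if h: "h \<in> closed_span A" for h
  proof -
    have "L2_inner h (\<lambda>z. u z - p z) = 0"
      using p by (intro closed_span_orthogonal[OF h] L2_torus_diff u closed_span_L2)
        (simp_all add: coef_diff u closed_span_L2)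
    then show ?thesis by (subst L2_inner_commute) simp
  qed
  with p have "?P p" by blast
  then have q: "?P (orth_proj (closed_span A) u)"
    unfolding orth_proj_def by (rule someI[of ?P])
  then show "orth_proj (closed_span A) u \<in> closed_span A" by simp
  then have "coef u \<mu> - coef (orth_proj (closed_span A) u) \<mu> = 0" if "\<mu> \<in> A"
    unfolding coef_def
    using q character_in_closed_span[OF that]
    by (subst L2_inner_diff_left[symmetric]) (auto simp: u closed_span_L2 L2_character)
  with q show "coef (orth_proj (closed_span A) u) \<mu> = (if \<mu> \<in> A then coef u \<mu> else 0)"
    using coef_closed_span_off[of "orth_proj (closed_span A) u" A \<mu>] by auto
qed

text \<open>Multiplication by a bounded \<open>f\<close> is convolution of the coefficients: move \<open>f\<close> to the other side of the
  inner product and apply Parseval's identity to \<open>cnj f * character \<delta>\<close>.\<close>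

lemma coef_mult_has_sum:
  assumes f: "f \<in> closed_span UNIV" "f \<in> Linf_torus" and w: "w \<in> L2_torus"
  shows "((\<lambda>\<mu>. coef f (\<delta> - \<mu>) * coef w \<mu>) has_sum coef (\<lambda>z. f z * w z) \<delta>) UNIV"
proof -
  define v where "v z = cnj (f z) * character \<delta> z" for z
  have "v \<in> closed_span ((\<lambda>\<mu>. \<mu> + \<delta>) ` uminus ` UNIV)"
    unfolding v_def[abs_def] by (intro closed_span_mult_character closed_span_cnj f)
  then have v: "v \<in> closed_span UNIV"
    using closed_span_mono by blast
  have "coef v \<mu> = cnj (coef f (\<delta> - \<mu>))" for \<mu>
    unfolding v_def[abs_def] coef_mult_character coef_cnj by simp
  with parseval[OF v w] have "((\<lambda>\<mu>. cnj (coef f (\<delta> - \<mu>) * coef w \<mu>)) has_sum L2_inner v w) UNIV"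
    by simp
  then have "((\<lambda>\<mu>. coef f (\<delta> - \<mu>) * coef w \<mu>) has_sum cnj (L2_inner v w)) UNIV"
    by (metis complex_cnj_cnj has_sum_cnj_iff)
  moreover have "cnj (L2_inner v w) = L2_inner w v"
    by (rule L2_inner_commute[symmetric])
  moreover have "L2_inner w v = coef (\<lambda>z. f z * w z) \<delta>"
    by (simp add: coef_def L2_inner_def v_def mult_ac)
  ultimately show ?thesis by simp
qed

section \<open>Hardy spaces and their projections\<close>

definition same_sign :: "(int \<times> int) set" where
  "same_sign = {\<mu>. (0 \<le> fst \<mu> \<and> 0 \<le> snd \<mu>) \<or> (fst \<mu> \<le> 0 \<and> snd \<mu> \<le> 0)}"

lemma same_sign_iff [simp]: "(m, n) \<in> same_sign \<longleftrightarrow> (0 \<le> m \<and> 0 \<le> n) \<or> (m \<le> 0 \<and> n \<le> 0)"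
  by (simp add: same_sign_def)

lemma uminus_same_sign_iff [simp]: "- \<mu> \<in> same_sign \<longleftrightarrow> \<mu> \<in> same_sign"
  by (cases \<mu>) auto

lemma prod_swap_same_sign_iff [simp]: "prod.swap \<mu> \<in> same_sign \<longleftrightarrow> \<mu> \<in> same_sign"
  by (cases \<mu>) auto

definition quadrant :: "(int \<times> int) set" where
  "quadrant = {\<mu>. 0 \<le> fst \<mu> \<and> 0 \<le> snd \<mu>}"

lemma quadrant_Un_uminus: "quadrant \<union> uminus ` quadrant = same_sign"
proof -
  have "uminus ` quadrant = {\<mu>. - \<mu> \<in> quadrant}"
    by force
  then show ?thesis
    by (auto simp: quadrant_def same_sign_def)
qed

text \<open>The analytic polynomials of the definition of \<open>H\<^sup>2\<close> are the trigonometric sums over boxes in the closed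
  first quadrant.\<close>

lemma analytic_poly_eq_trig_sum:
  "(\<Sum>j\<le>n. \<Sum>k\<le>n. c j k * fst z ^ j * snd z ^ k) =
    trig_sum (\<lambda>\<mu>. c (nat (fst \<mu>)) (nat (snd \<mu>))) ({0..int n} \<times> {0..int n}) z"
proof -
  have "trig_sum (\<lambda>\<mu>. c (nat (fst \<mu>)) (nat (snd \<mu>))) ({0..int n} \<times> {0..int n}) z =
      (\<Sum>(j, k)\<in>{..n} \<times> {..n}. c j k * fst z ^ j * snd z ^ k)"
    unfolding trig_sum_def
    by (rule sum.reindex_bij_witness[where i = "\<lambda>(j, k). (int j, int k)" and
          j = "\<lambda>\<mu>. (nat (fst \<mu>), nat (snd \<mu>))"])
       (auto simp: character_def power_int_nonneg_exp mult.assoc)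
  then show ?thesis
    by (simp add: sum.cartesian_product)
qed

lemma H2_torus_eq: "H2_torus = closed_span quadrant"
proof -
  have "(\<exists>p\<in>analytic_polys. L2_norm (\<lambda>z. f z - p z) < e) \<longleftrightarrow>
      (\<exists>F c. finite F \<and> F \<subseteq> quadrant \<and> L2_norm (\<lambda>z. f z - trig_sum c F z) < e)" for f and e :: real
  proof
    assume "\<exists>p\<in>analytic_polys. L2_norm (\<lambda>z. f z - p z) < e"
    then obtain n c where "L2_norm (\<lambda>z. f z - (\<Sum>j\<le>n. \<Sum>k\<le>n. c j k * fst z ^ j * snd z ^ k)) < e"
      by (auto simp: analytic_polys_def)
    then show "\<exists>F c. finite F \<and> F \<subseteq> quadrant \<and> L2_norm (\<lambda>z. f z - trig_sum c F z) < e"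
      unfolding analytic_poly_eq_trig_sum
      by (intro exI[of _ "{0..int n} \<times> {0..int n}"]) (auto simp: quadrant_def)
  next
    assume "\<exists>F c. finite F \<and> F \<subseteq> quadrant \<and> L2_norm (\<lambda>z. f z - trig_sum c F z) < e"
    then obtain F c where F: "finite F" "F \<subseteq> quadrant" "L2_norm (\<lambda>z. f z - trig_sum c F z) < e"
      by blast
    define n where "n = nat (Max (insert 0 (fst ` F \<union> snd ` F)))"
    have "fst \<mu> \<le> int n" "snd \<mu> \<le> int n" if "\<mu> \<in> F" for \<mu>
    proof -
      have "fst \<mu> \<le> Max (insert 0 (fst ` F \<union> snd ` F))" "snd \<mu> \<le> Max (insert 0 (fst ` F \<union> snd ` F))"
        using F(1) that by (auto intro!: Max_ge)
      then show "fst \<mu> \<le> int n" "snd \<mu> \<le> int n" by (auto simp: n_def)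
    qed
    then have sub: "F \<subseteq> {0..int n} \<times> {0..int n}"
      using F(2) by (force simp: quadrant_def)
    define d where "d j k = (if (int j, int k) \<in> F then c (int j, int k) else 0)" for j k
    have "trig_sum c F z = (\<Sum>j\<le>n. \<Sum>k\<le>n. d j k * fst z ^ j * snd z ^ k)" for z
      unfolding analytic_poly_eq_trig_sum trig_sum_def d_def using sub
      by (intro sum.mono_neutral_cong_left) auto
    with F(3) show "\<exists>p\<in>analytic_polys. L2_norm (\<lambda>z. f z - p z) < e"
      by (auto simp: analytic_polys_def)
  qed
  then show ?thesis
    by (simp add: H2_torus_def closed_span_def)
qed

text \<open>For the inclusion from right to left, split \<open>f\<close> into its part \<open>u\<close> with frequencies in the quadrant
  and the remainder, whose conjugate again has frequencies in the quadrant.\<close>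

lemma h2_torus_eq: "h2_torus = closed_span same_sign"
proof (intro subset_antisym subsetI)
  fix f assume "f \<in> h2_torus"
  then obtain u v where uv: "u \<in> closed_span quadrant" "v \<in> closed_span quadrant"
    and f: "f = (\<lambda>z. u z + cnj (v z))"
    by (auto simp: h2_torus_def H2_torus_eq)
  have "quadrant \<subseteq> same_sign" "uminus ` quadrant \<subseteq> same_sign"
    by (auto simp flip: quadrant_Un_uminus)
  then show "f \<in> closed_span same_sign"
    unfolding f using uv(1) closed_span_cnj[OF uv(2)]
    by (intro closed_span_add) (auto dest: closed_span_mono)
next
  fix f assume f: "f \<in> closed_span same_sign"
  define u where "u = orth_proj (closed_span quadrant) f"
  note u = orth_proj_closed_span[OF closed_span_L2[OF f], of quadrant, folded u_def]
  have sub: "quadrant \<subseteq> same_sign"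
    by (auto simp flip: quadrant_Un_uminus)
  have "(\<lambda>z. f z - u z) \<in> closed_span (uminus ` quadrant)"
  proof (rule closed_span_restrict[where A = same_sign])
    show "(\<lambda>z. f z - u z) \<in> closed_span same_sign"
      using f u(1) closed_span_mono[OF sub] by (intro closed_span_diff) auto
    fix \<mu> assume "\<mu> \<in> same_sign" "\<mu> \<notin> uminus ` quadrant"
    then have "\<mu> \<in> quadrant" by (auto simp flip: quadrant_Un_uminus)
    then show "coef (\<lambda>z. f z - u z) \<mu> = 0"
      by (simp add: coef_diff closed_span_L2[OF f] closed_span_L2[OF u(1)] u(2))
  qed
  from closed_span_cnj[OF this] have "(\<lambda>z. cnj (f z - u z)) \<in> closed_span quadrant"
    by (simp add: image_image)
  with u(1) show "f \<in> h2_torus"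
    unfolding h2_torus_def H2_torus_eq
    by (intro CollectI exI[of _ u] exI[of _ "\<lambda>z. cnj (f z - u z)"] conjI) simp_all
qed

lemma plus_part_h2:
  assumes f: "f \<in> h2_torus"
  shows "plus_part f \<in> closed_span quadrant"
    and "coef (plus_part f) \<mu> = (if \<mu> \<in> quadrant then coef f \<mu> else 0)"
  using orth_proj_closed_span[OF closed_span_L2[OF f[unfolded h2_torus_eq]], of quadrant]
  by (simp_all add: plus_part_def P_proj_def H2_torus_eq)

lemma minus_part_h2:
  assumes f: "f \<in> h2_torus"
  shows "minus_part f \<in> closed_span same_sign"
    and "coef (minus_part f) \<mu> = (if \<mu> \<in> quadrant then 0 else coef f \<mu>)"
proof -
  note f' = f[unfolded h2_torus_eq]
  note Q = orth_proj_closed_span[OF closed_span_L2[OF f'], of same_sign]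
  note P = orth_proj_closed_span[OF closed_span_L2[OF f'], of quadrant]
  have sub: "quadrant \<subseteq> same_sign"
    by (auto simp flip: quadrant_Un_uminus)
  have eq: "minus_part f =
      (\<lambda>z. orth_proj (closed_span same_sign) f z - orth_proj (closed_span quadrant) f z)"
    by (simp add: minus_part_def Q_proj_def P_proj_def H2_torus_eq h2_torus_eq)
  show "minus_part f \<in> closed_span same_sign"
    unfolding eq using Q(1) P(1) closed_span_mono[OF sub] by (intro closed_span_diff) auto
  show "coef (minus_part f) \<mu> = (if \<mu> \<in> quadrant then 0 else coef f \<mu>)"
    unfolding eq using sub coef_closed_span_off[OF f', of \<mu>]
    by (auto simp: coef_diff closed_span_L2[OF Q(1)] closed_span_L2[OF P(1)] Q(2) P(2))
qed

section \<open>Functions of one variable\<close>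

text \<open>A sequence of trigonometric polynomials converging to \<open>u\<close> in \<open>L\<^sup>2\<close> has a subsequence that converges
  almost everywhere. Its members factor through \<open>\<pi>\<close>, hence so does the limit. This is used with the
  two coordinate projections for \<open>\<pi>\<close>.\<close>

lemma factor_through_if_characters_factor:
  assumes u: "u \<in> closed_span B"
    and \<pi>: "\<pi> \<in> measurable torus_haar circle_haar"
    and char: "\<And>\<mu> z. \<mu> \<in> B \<Longrightarrow> character \<mu> z = \<pi> z powi k \<mu>"
  shows "\<exists>\<phi>\<in>borel_measurable circle_haar. AE z in torus_haar. u z = \<phi> (\<pi> z)"
proof -
  have "\<exists>F c. F \<subseteq> B \<and> L2_norm (\<lambda>z. u z - trig_sum c F z) < 1 / real (Suc n)" for n
    using closed_spanE[OF u, of "1 / real (Suc n)"] by (metis of_nat_0_less_iff zero_less_Suc zero_less_divide_1_iff)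
  then obtain F c where F: "\<And>n. F n \<subseteq> B"
    and bound: "\<And>n. L2_norm (\<lambda>z. u z - trig_sum (c n) (F n) z) < 1 / real (Suc n)"
    by metis
  have "(\<lambda>n. L2_norm (\<lambda>z. trig_sum (c n) (F n) z - u z)) \<longlonglongrightarrow> 0"
  proof (rule tendsto_sandwich[OF _ _ tendsto_const LIMSEQ_Suc[OF lim_1_over_n]])
    show "\<forall>\<^sub>F n in sequentially. L2_norm (\<lambda>z. trig_sum (c n) (F n) z - u z) \<le> 1 / of_nat (Suc n)"
      using bound less_imp_le
      by (intro always_eventually) (simp add: L2_norm_diff_commute[of "trig_sum (c _) (F _)" u] less_imp_le)
  qed simp
  from L2_limit_imp_AE_subseq[OF L2_trig_sum closed_span_L2[OF u] this] obtain r where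
    r: "AE z in torus_haar. (\<lambda>n. trig_sum (c (r n)) (F (r n)) z) \<longlonglongrightarrow> u z" .
  define q where "q n x = (\<Sum>\<mu>\<in>F n. c n \<mu> * x powi k \<mu>)" for n and x :: complex
  have "trig_sum (c n) (F n) z = q n (\<pi> z)" for n z
    unfolding trig_sum_def q_def
  proof (rule sum.cong[OF refl])
    fix \<mu> assume "\<mu> \<in> F n"
    with F have "\<mu> \<in> B" by blast
    then show "c n \<mu> * character \<mu> z = c n \<mu> * \<pi> z powi k \<mu>" by (simp only: char)
  qed
  with r have conv: "AE z in torus_haar. (\<lambda>n. q (r n) (\<pi> z)) \<longlonglongrightarrow> u z"
    by simp
  have [measurable]: "q n \<in> borel_measurable circle_haar" for n
    unfolding q_def
    by (intro borel_measurable_sum borel_measurable_times borel_measurable_const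
        borel_measurable_circle_haar borel_measurable_power_int)
  have "(\<lambda>x. lim (\<lambda>n. q (r n) x)) \<in> borel_measurable circle_haar"
    by measurable
  moreover have "AE z in torus_haar. u z = lim (\<lambda>n. q (r n) (\<pi> z))"
    using conv by eventually_elim (rule limI[symmetric])
  ultimately show ?thesis
    by (intro bexI[of _ "\<lambda>x. lim (\<lambda>n. q (r n) x)"])
qed

lemma depends_only_z1_iff:
  assumes u: "u \<in> closed_span A"
  shows "depends_only_z1 u \<longleftrightarrow> (\<forall>\<mu>. snd \<mu> \<noteq> 0 \<longrightarrow> coef u \<mu> = 0)"
proof
  assume "\<forall>\<mu>. snd \<mu> \<noteq> 0 \<longrightarrow> coef u \<mu> = 0"
  then have "u \<in> closed_span {\<mu>. snd \<mu> = 0}"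
    by (intro closed_span_restrict[OF u]) auto
  then show "depends_only_z1 u"
    unfolding depends_only_z1_def
    by (rule factor_through_if_characters_factor[where k = fst]) (auto simp: character_def)
next
  assume "depends_only_z1 u"
  then obtain \<phi> where [measurable]: "\<phi> \<in> borel_measurable circle_haar"
    and \<phi>: "AE z in torus_haar. u z = \<phi> (fst z)"
    by (auto simp: depends_only_z1_def)
  have L2: "(\<lambda>z. \<phi> (fst z)) \<in> L2_torus"
    using \<phi> L2_torusD(2)[OF closed_span_L2[OF u]] by (intro L2_torusI_le[where g = "\<lambda>z. (cmod (u z))\<^sup>2"]) auto
  show "\<forall>\<mu>. snd \<mu> \<noteq> 0 \<longrightarrow> coef u \<mu> = 0"
  proof (intro allI impI)
    fix \<mu> :: "int \<times> int" assume \<mu>: "snd \<mu> \<noteq> 0"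
    have "coef u \<mu> = coef (\<lambda>z. \<phi> (fst z)) \<mu>"
      by (rule coef_cong_AE[OF closed_span_L2[OF u] L2 \<phi>])
    also have "\<dots> = (LINT x|circle_haar. LINT y|circle_haar. \<phi> x * cnj (character \<mu> (x, y)))"
      using integrable_L2_mult_cnj[OF L2 L2_character, of \<mu>]
      unfolding coef_def L2_inner_def torus_haar_def
      by (subst torus_pair.integral_fst'[symmetric]) (simp_all add: case_prod_beta')
    also have "\<dots> = (LINT x|circle_haar. \<phi> x * cnj (x powi fst \<mu>) *
        cnj (LINT y|circle_haar. y powi snd \<mu>))"
      unfolding Bochner_Integration.integral_cnj[symmetric]
      by (simp add: character_def flip: mult.assoc)
    also have "\<dots> = 0"
      using \<mu> by (simp add: integral_circle_powi)
    finally show "coef u \<mu> = 0" .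
  qed
qed

lemma depends_only_z2_iff:
  assumes u: "u \<in> closed_span A"
  shows "depends_only_z2 u \<longleftrightarrow> (\<forall>\<mu>. fst \<mu> \<noteq> 0 \<longrightarrow> coef u \<mu> = 0)"
proof
  assume "\<forall>\<mu>. fst \<mu> \<noteq> 0 \<longrightarrow> coef u \<mu> = 0"
  then have "u \<in> closed_span {\<mu>. fst \<mu> = 0}"
    by (intro closed_span_restrict[OF u]) auto
  then show "depends_only_z2 u"
    unfolding depends_only_z2_def
    by (rule factor_through_if_characters_factor[where k = snd]) (auto simp: character_def)
next
  assume "depends_only_z2 u"
  then obtain \<phi> where [measurable]: "\<phi> \<in> borel_measurable circle_haar"
    and \<phi>: "AE z in torus_haar. u z = \<phi> (snd z)"
    by (auto simp: depends_only_z2_def)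
  have L2: "(\<lambda>z. \<phi> (snd z)) \<in> L2_torus"
    using \<phi> L2_torusD(2)[OF closed_span_L2[OF u]] by (intro L2_torusI_le[where g = "\<lambda>z. (cmod (u z))\<^sup>2"]) auto
  show "\<forall>\<mu>. fst \<mu> \<noteq> 0 \<longrightarrow> coef u \<mu> = 0"
  proof (intro allI impI)
    fix \<mu> :: "int \<times> int" assume \<mu>: "fst \<mu> \<noteq> 0"
    have "coef u \<mu> = coef (\<lambda>z. \<phi> (snd z)) \<mu>"
      by (rule coef_cong_AE[OF closed_span_L2[OF u] L2 \<phi>])
    also have "\<dots> = (LINT y|circle_haar. LINT x|circle_haar. \<phi> y * cnj (character \<mu> (x, y)))"
      using integrable_L2_mult_cnj[OF L2 L2_character, of \<mu>]
      unfolding coef_def L2_inner_def torus_haar_def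
      by (subst torus_pair.integral_snd) (simp_all add: case_prod_beta')
    also have "\<dots> = (LINT y|circle_haar. \<phi> y * cnj (y powi snd \<mu>) *
        cnj (LINT x|circle_haar. x powi fst \<mu>))"
      unfolding Bochner_Integration.integral_cnj[symmetric]
      by (simp add: character_def mult_ac)
    also have "\<dots> = 0"
      using \<mu> by (simp add: integral_circle_powi)
    finally show "coef u \<mu> = 0" .
  qed
qed

lemma ae_constant_iff:
  assumes u: "u \<in> closed_span A"
  shows "ae_constant u \<longleftrightarrow> (\<forall>\<mu>. \<mu> \<noteq> 0 \<longrightarrow> coef u \<mu> = 0)"
proof
  have one: "character 0 z = 1" for z
    by (simp add: character_def)
  {
    assume "\<forall>\<mu>. \<mu> \<noteq> 0 \<longrightarrow> coef u \<mu> = 0"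
    then have "u \<in> closed_span {0}"
      by (intro closed_span_restrict[OF u]) auto
    then have "AE z in torus_haar. u z = trig_sum (coef u) {0} z"
      by (rule closed_span_eqI) (auto intro: trig_sum_in_closed_span simp: coef_trig_sum)
    then show "ae_constant u"
      unfolding ae_constant_def by (auto simp: trig_sum_def one)
  next
    assume "ae_constant u"
    then obtain c where "AE z in torus_haar. u z = c"
      by (auto simp: ae_constant_def)
    then have "AE z in torus_haar. u z = trig_sum (\<lambda>_. c) {0} z"
      by (simp add: trig_sum_def one)
    then have "coef u \<mu> = coef (trig_sum (\<lambda>_. c) {0}) \<mu>" for \<mu>
      by (intro coef_cong_AE closed_span_L2[OF u] L2_trig_sum)
    then show "\<forall>\<mu>. \<mu> \<noteq> 0 \<longrightarrow> coef u \<mu> = 0"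
      by (simp add: coef_trig_sum)
  }
qed

section \<open>Pairs of coefficient arrays with vanishing defect\<close>

text \<open>The matrix entries of \<open>T\<^sub>f T\<^sub>g - T\<^sub>f\<^sub>g\<close> vanish, expressed in the coefficients \<open>a\<close> of \<open>f\<close> and \<open>b\<close> of
  \<open>g\<close>.\<close>

definition semicommuting :: "(int \<times> int \<Rightarrow> complex) \<Rightarrow> (int \<times> int \<Rightarrow> complex) \<Rightarrow> bool" where
  "semicommuting a b \<longleftrightarrow>
     (\<forall>\<mu>. \<mu> \<notin> same_sign \<longrightarrow> a \<mu> = 0 \<and> b \<mu> = 0) \<and>
     (\<forall>\<gamma>\<in>same_sign. \<forall>\<delta>\<in>same_sign.
        ((\<lambda>\<mu>. a (\<delta> - \<mu>) * b (\<mu> - \<gamma>)) has_sum 0) (- same_sign))"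

lemma semicommuting_support:
  assumes "semicommuting a b" "\<mu> \<notin> same_sign"
  shows "a \<mu> = 0" "b \<mu> = 0"
  using assms unfolding semicommuting_def by blast+

lemma semicommuting_uminus:
  assumes "semicommuting a b"
  shows "semicommuting (\<lambda>\<mu>. a (- \<mu>)) (\<lambda>\<mu>. b (- \<mu>))"
  unfolding semicommuting_def
proof (intro conjI ballI)
  show "\<forall>\<mu>. \<mu> \<notin> same_sign \<longrightarrow> a (- \<mu>) = 0 \<and> b (- \<mu>) = 0"
    using semicommuting_support[OF assms] by simp
  fix \<gamma> \<delta> assume *: "\<gamma> \<in> same_sign" "\<delta> \<in> same_sign"
  have "((\<lambda>\<mu>. a (- \<delta> - \<mu>) * b (\<mu> - - \<gamma>)) has_sum 0) (- same_sign)"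
    using assms * by (simp add: semicommuting_def del: diff_minus_eq_add)
  also have "?this \<longleftrightarrow> ((\<lambda>\<mu>. a (- (\<delta> - \<mu>)) * b (- (\<mu> - \<gamma>))) has_sum 0) (- same_sign)"
    by (rule has_sum_reindex_bij_witness[where i = uminus and j = uminus])
       (simp_all add: algebra_simps minus_diff_commute)
  finally show "((\<lambda>\<mu>. a (- (\<delta> - \<mu>)) * b (- (\<mu> - \<gamma>))) has_sum 0) (- same_sign)" .
qed

lemma semicommuting_swap:
  assumes "semicommuting a b"
  shows "semicommuting (a \<circ> prod.swap) (b \<circ> prod.swap)"
  unfolding semicommuting_def
proof (intro conjI ballI)
  show "\<forall>\<mu>. \<mu> \<notin> same_sign \<longrightarrow> (a \<circ> prod.swap) \<mu> = 0 \<and> (b \<circ> prod.swap) \<mu> = 0"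
    using semicommuting_support[OF assms] by simp
  fix \<gamma> \<delta> assume *: "\<gamma> \<in> same_sign" "\<delta> \<in> same_sign"
  have "((\<lambda>\<mu>. a (prod.swap \<delta> - \<mu>) * b (\<mu> - prod.swap \<gamma>)) has_sum 0) (- same_sign)"
    using assms * by (simp add: semicommuting_def)
  also have "?this \<longleftrightarrow> ((\<lambda>\<mu>. (a \<circ> prod.swap) (\<delta> - \<mu>) * (b \<circ> prod.swap) (\<mu> - \<gamma>)) has_sum 0) (- same_sign)"
    by (rule has_sum_reindex_bij_witness[where i = prod.swap and j = prod.swap])
       (auto simp: prod.swap_def)
  finally show "((\<lambda>\<mu>. (a \<circ> prod.swap) (\<delta> - \<mu>) * (b \<circ> prod.swap) (\<mu> - \<gamma>)) has_sum 0) (- same_sign)" .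
qed

text \<open>This symmetry corresponds to taking adjoints: \<open>T\<^sub>f T\<^sub>g = T\<^sub>f\<^sub>g\<close> if and only if the symbols \<open>cnj g\<close>,
  \<open>cnj f\<close> have the same property.\<close>

lemma semicommuting_exchange:
  assumes "semicommuting a b"
  shows "semicommuting (\<lambda>\<mu>. b (- \<mu>)) (\<lambda>\<mu>. a (- \<mu>))"
  using assms unfolding semicommuting_def by (auto simp: mult.commute)

text \<open>The condition in terms of \<open>\<beta> = \<mu> - \<gamma>\<close> and \<open>\<tau> = \<delta> - \<gamma>\<close>. With \<open>\<tau>\<close> fixed, the summand is
  always the same and only the index set depends on \<open>\<gamma>\<close>.\<close>

lemma semicommuting_has_sum:
  assumes "semicommuting a b" "\<gamma> \<in> same_sign" "\<gamma> + \<tau> \<in> same_sign"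
  shows "((\<lambda>\<beta>. a (\<tau> - \<beta>) * b \<beta>) has_sum 0) {\<beta>. \<gamma> + \<beta> \<notin> same_sign}"
proof -
  have "((\<lambda>\<mu>. a (\<gamma> + \<tau> - \<mu>) * b (\<mu> - \<gamma>)) has_sum 0) (- same_sign)"
    using assms by (simp add: semicommuting_def)
  also have "?this \<longleftrightarrow> ((\<lambda>\<beta>. a (\<tau> - \<beta>) * b \<beta>) has_sum 0) {\<beta>. \<gamma> + \<beta> \<notin> same_sign}"
    by (rule has_sum_reindex_bij_witness[where i = "\<lambda>\<beta>. \<gamma> + \<beta>" and j = "\<lambda>\<mu>. \<mu> - \<gamma>"])
       (auto simp: algebra_simps)
  finally show ?thesis .
qed

text \<open>The points strictly to the upper left or strictly to the lower right of \<open>(p, q)\<close>. They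
  are the \<open>x\<close> in the first quadrant for which \<open>(p, q) - x\<close> lies outside \<open>same_sign\<close>.\<close>

definition corners :: "nat \<Rightarrow> nat \<Rightarrow> (nat \<times> nat) set" where
  "corners p q = {x. (fst x < p \<and> q < snd x) \<or> (p < fst x \<and> snd x < q)}"

lemma has_sum_of_bool_iff:
  fixes f :: "'a \<Rightarrow> complex"
  shows "(f has_sum s) A \<longleftrightarrow> ((\<lambda>x. of_bool (x \<in> A) * f x) has_sum s) UNIV"
  by (rule has_sum_cong_neutral) auto

lemma has_sum_diff_0:
  fixes f g :: "'a \<Rightarrow> complex"
  assumes "(f has_sum 0) A" "(g has_sum 0) A"
  shows "((\<lambda>x. f x - g x) has_sum 0) A"
  using has_sum_add[OF assms(1), of "\<lambda>x. - g x" 0] assms(2) by (simp add: has_sum_uminus)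

lemma has_sum_Diff_0:
  fixes f :: "'a \<Rightarrow> complex"
  assumes "(f has_sum 0) A" "(f has_sum 0) B" "B \<subseteq> A"
  shows "(f has_sum 0) (A - B)"
  using has_sum_Diff[OF assms] by simp

text \<open>Second differences of the corner sums show that \<open>R\<close> alternates along antidiagonals, and first
  differences at the bottom that the part of each row \<open>{p} \<times> \<nat>\<close> with positive second entry sums to
  zero. Alternation turns that sum for \<open>p + 1\<close>, up to sign, into the same sum for \<open>p\<close> with its first
  term removed, so the first term is zero; alternation then carries the zeros to all antidiagonals except
  the trivial one through the origin.\<close>

lemma vanish_off_origin_if_corner_sums_0:
  fixes R :: "nat \<times> nat \<Rightarrow> complex"
  assumes sums: "\<And>p q. (R has_sum 0) (corners p q)"
    and "x \<noteq> (0, 0)"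
  shows "R x = 0"
proof -
  \<comment> \<open>The indicator functions of the four index sets below combine to that of two neighbours on an
    antidiagonal.\<close>
  have alt: "R (p, Suc q) = - R (Suc p, q)" for p q
  proof -
    let ?\<chi> = "\<lambda>p q x. of_bool (x \<in> corners p q) :: complex"
    have "((\<lambda>x. ?\<chi> p' q' x * R x) has_sum 0) UNIV" for p' q'
      using sums[of p' q'] by (simp add: has_sum_of_bool_iff[of R])
    from has_sum_diff_0[OF has_sum_add[OF this this, simplified] has_sum_add[OF this this, simplified],
        of "Suc p" q p "Suc q" p q "Suc p" "Suc q"]
    have "((\<lambda>x. ?\<chi> (Suc p) q x * R x + ?\<chi> p (Suc q) x * R x -
        (?\<chi> p q x * R x + ?\<chi> (Suc p) (Suc q) x * R x)) has_sum 0) UNIV" by simp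
    also have "?this \<longleftrightarrow> (R has_sum 0) {(p, Suc q), (Suc p, q)}"
      by (rule has_sum_cong_neutral) (auto simp: corners_def split: if_splits)
    also have "\<dots> \<longleftrightarrow> R (p, Suc q) + R (Suc p, q) = 0"
      by (simp add: has_sum_iff)
    finally show ?thesis by (simp add: eq_neg_iff_add_eq_0)
  qed
  have row: "(\<lambda>j. R (p, Suc j)) sums 0" for p
  proof -
    have "(R has_sum 0) (corners (Suc p) 0 - corners p 0)"
      by (rule has_sum_Diff_0) (auto simp: sums, auto simp: corners_def)
    also have "?this \<longleftrightarrow> ((\<lambda>j. R (p, Suc j)) has_sum 0) UNIV"
      by (rule has_sum_reindex_bij_witness[where j = "\<lambda>x. snd x - 1" and i = "\<lambda>j. (p, Suc j)"])
         (auto simp: corners_def less_Suc_eq)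
    finally show ?thesis by (rule has_sum_imp_sums)
  qed
  have col1: "R (p, Suc 0) = 0" for p
  proof -
    have "(\<lambda>j. R (p, Suc (Suc j))) sums 0"
      using sums_minus[OF row[of "Suc p"]] by (simp add: alt)
    then have "(\<lambda>j. R (p, Suc j)) sums (0 + R (p, Suc 0))"
      by (rule sums_Suc)
    with row[of p] show ?thesis
      by (metis add_0 sums_unique2)
  qed
  have pos: "R (p, Suc q) = 0" for p q
  proof (induction q arbitrary: p)
    case (Suc q)
    then show ?case using alt[of p "Suc q"] by simp
  qed (rule col1)
  obtain p q where x: "x = (p, q)" by (cases x)
  show ?thesis
  proof (cases q)
    case 0
    with assms(2) x obtain p' where "p = Suc p'" by (cases p) auto
    with alt[of p' 0] pos[of p' 0] x 0 show ?thesis by simp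
  qed (use x pos in auto)
qed

text \<open>With \<open>\<tau> = \<alpha> - \<beta>\<close> the products \<open>a (\<tau> + (i, j)) * b (- i, - j)\<close> satisfy the corner conditions.
  When \<open>\<tau>\<close> points to the lower right, the factor \<open>a\<close> vanishes until \<open>j\<close> has reached \<open>- snd \<tau>\<close>,
  and the grid is shifted upwards by that amount \<open>q0\<close>. The corner \<open>(0, q0)\<close> of the shifted grid is the
  product on which there is no condition, and the last hypothesis excludes it.\<close>

lemma mixed_product_zero_if_right:
  assumes ab: "semicommuting a b"
    and pos: "0 \<le> fst \<alpha>" "0 \<le> snd \<alpha>" "0 \<le> fst \<beta>" "0 \<le> snd \<beta>"
    and le: "fst \<beta> \<le> fst \<alpha>" "fst \<beta> < fst \<alpha> \<or> snd \<beta> \<le> snd \<alpha>"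
    and ne: "fst \<beta> \<noteq> 0 \<or> snd \<alpha> \<noteq> 0 \<and> snd \<beta> \<noteq> 0"
  shows "a \<alpha> * b (- \<beta>) = 0"
proof -
  define s t :: int where "s = fst \<alpha> - fst \<beta>" and "t = snd \<alpha> - snd \<beta>"
  define q0 where "q0 = max 0 (- t)"
  define R :: "nat \<times> nat \<Rightarrow> complex" where
    "R x = a (s + int (fst x), t + q0 + int (snd x)) * b (- int (fst x), - (q0 + int (snd x)))" for x
  note supp = semicommuting_support[OF ab]
  have st: "s \<ge> 0" "s \<ge> 1 \<or> t \<ge> 0"
    using le by (auto simp: s_def t_def)
  have "(R has_sum 0) (corners p q)" for p q
  proof -
    define \<gamma> where "\<gamma> = (int p, int q + q0)"
    have "((\<lambda>\<beta>. a ((s, t) - \<beta>) * b \<beta>) has_sum 0) {\<beta>. \<gamma> + \<beta> \<notin> same_sign}"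
      using st by (intro semicommuting_has_sum[OF ab]) (auto simp: \<gamma>_def q0_def)
    also have "?this \<longleftrightarrow> ((\<lambda>\<beta>. a ((s, t) - \<beta>) * b \<beta>) has_sum 0)
        ((\<lambda>x. (- int (fst x), - (q0 + int (snd x)))) ` corners p q)"
    proof (rule has_sum_cong_neutral)
      fix \<beta> assume \<beta>: "\<beta> \<in> {\<beta>. \<gamma> + \<beta> \<notin> same_sign} -
        (\<lambda>x. (- int (fst x), - (q0 + int (snd x)))) ` corners p q"
      obtain u v where uv: "\<beta> = (u, v)" by (cases \<beta>)
      show "a ((s, t) - \<beta>) * b \<beta> = 0"
      proof (rule ccontr)
        assume "a ((s, t) - \<beta>) * b \<beta> \<noteq> 0"
        then have mem: "(s - u, t - v) \<in> same_sign" "(u, v) \<in> same_sign"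
          using supp uv by fastforce+
        moreover have \<gamma>\<beta>: "(int p + u, int q + q0 + v) \<notin> same_sign"
          using \<beta> uv by (auto simp: \<gamma>_def)
        ultimately have "u \<le> 0" "v \<le> 0"
          by (auto simp: q0_def)
        have "- v \<ge> q0"
          using mem st \<open>u \<le> 0\<close> \<open>v \<le> 0\<close> by (auto simp: q0_def)
        define x where "x = (nat (- u), nat (- v - q0))"
        have "\<beta> = (- int (fst x), - (q0 + int (snd x)))"
          using \<open>u \<le> 0\<close> \<open>- v \<ge> q0\<close> uv by (simp add: x_def)
        moreover have "x \<in> corners p q"
          using \<gamma>\<beta> \<open>u \<le> 0\<close> \<open>- v \<ge> q0\<close> by (auto simp: x_def corners_def)
        ultimately show False using \<beta> by blast
      qed
    qed (auto simp: \<gamma>_def corners_def)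
    also have "\<dots> \<longleftrightarrow> (R has_sum 0) (corners p q)"
    proof (subst has_sum_reindex)
      show "inj_on (\<lambda>x. (- int (fst x), - (q0 + int (snd x)))) (corners p q)"
        by (auto simp: inj_on_def prod_eq_iff)
    qed (rule has_sum_cong, simp add: R_def algebra_simps)
    finally show ?thesis .
  qed
  moreover have "(nat (fst \<beta>), nat (snd \<beta> - q0)) \<noteq> (0, 0)"
    using pos ne by (auto simp: q0_def t_def)
  ultimately have "R (nat (fst \<beta>), nat (snd \<beta> - q0)) = 0"
    by (rule vanish_off_origin_if_corner_sums_0)
  moreover have "int (nat (fst \<beta>)) = fst \<beta>" "int (nat (snd \<beta> - q0)) = snd \<beta> - q0"
    using pos by (auto simp: q0_def t_def)
  moreover have "\<alpha> = (s + fst \<beta>, t + q0 + (snd \<beta> - q0))" "- \<beta> = (- fst \<beta>, - (q0 + (snd \<beta> - q0)))"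
    by (simp_all add: s_def t_def prod_eq_iff)
  ultimately show ?thesis
    by (metis R_def fst_conv snd_conv)
qed

text \<open>Either \<open>\<alpha>\<close> lies to the right of \<open>\<beta>\<close> (or not below it in the same column), or the adjoint pair is in that
  position.\<close>

lemma mixed_product_zero:
  assumes ab: "semicommuting a b"
    and pos: "0 \<le> fst \<alpha>" "0 \<le> snd \<alpha>" "0 \<le> fst \<beta>" "0 \<le> snd \<beta>"
    and ne0: "\<alpha> \<noteq> 0" "\<beta> \<noteq> 0"
    and ne: "a \<alpha> * b (- \<beta>) \<noteq> 0"
  shows "(snd \<alpha> = 0 \<and> fst \<beta> = 0) \<or> (fst \<alpha> = 0 \<and> snd \<beta> = 0)"
proof -
  have "\<alpha> \<noteq> 0 \<longleftrightarrow> fst \<alpha> \<noteq> 0 \<or> snd \<alpha> \<noteq> 0" "\<beta> \<noteq> 0 \<longleftrightarrow> fst \<beta> \<noteq> 0 \<or> snd \<beta> \<noteq> 0"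
    by (auto simp: prod_eq_iff)
  note nz = this
  consider "fst \<beta> \<le> fst \<alpha>" "fst \<beta> < fst \<alpha> \<or> snd \<beta> \<le> snd \<alpha>"
    | "fst \<alpha> \<le> fst \<beta>" "fst \<alpha> < fst \<beta> \<or> snd \<alpha> \<le> snd \<beta>"
    by linarith
  then show ?thesis
  proof cases
    case 1
    from mixed_product_zero_if_right[OF ab pos 1] ne show ?thesis
      using nz ne0 by auto
  next
    case 2
    from mixed_product_zero_if_right[OF semicommuting_exchange[OF ab] pos(3,4,1,2) 2] ne show ?thesis
      using nz ne0 by (auto simp: mult.commute)
  qed
qed

text \<open>Here \<open>\<gamma>\<close> runs through the points \<open>(0, - q')\<close>. Mixed products with \<open>\<tau>\<close> in the closed first quadrant
  vanish by the preceding result, so the sums are finite and involve only frequencies in the rectangle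
  spanned by \<open>0\<close> and \<open>\<tau>\<close>. Subtracting the sums for \<open>q' = q\<close> and \<open>q' = q + 1\<close> leaves row \<open>q\<close>
  without its first entry, which is a coefficient of a product of two power series.\<close>

lemma analytic_product_dichotomy:
  assumes ab: "semicommuting a b"
  shows "(\<forall>\<mu>. 0 \<le> fst \<mu> \<and> 0 < snd \<mu> \<longrightarrow> a \<mu> = 0) \<or> (\<forall>\<mu>. 0 < fst \<mu> \<and> 0 \<le> snd \<mu> \<longrightarrow> b \<mu> = 0)"
proof -
  note supp = semicommuting_support[OF ab]
  have mixed: "a (- \<alpha>) * b \<beta> = 0"
    if "0 \<le> fst \<alpha>" "0 \<le> snd \<alpha>" "fst \<alpha> \<le> fst \<beta>" "snd \<alpha> \<le> snd \<beta>" "\<alpha> \<noteq> 0" for \<alpha> \<beta>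
  proof (rule ccontr)
    assume "a (- \<alpha>) * b \<beta> \<noteq> 0"
    with mixed_product_zero[OF semicommuting_uminus[OF ab], of \<alpha> \<beta>] that show False
      by (auto simp: prod_eq_iff)
  qed
  have conv: "(\<Sum>i=1..m. b (int i, int q) * a (int (m - i), int r)) = 0" if "r > 0" for m q r
  proof -
    define n where "n = q + r"
    define S :: "nat \<times> nat \<Rightarrow> complex" where
      "S x = (if fst x \<le> m \<and> snd x \<le> n
              then a (int m - int (fst x), int n - int (snd x)) * b (int (fst x), int (snd x)) else 0)" for x
    have sumS: "(S has_sum 0) (corners 0 q')" if "q' \<le> n" for q'
    proof -
      define \<gamma> where "\<gamma> = (0::int, - int q')"
      have "((\<lambda>\<beta>. a ((int m, int n) - \<beta>) * b \<beta>) has_sum 0) {\<beta>. \<gamma> + \<beta> \<notin> same_sign}"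
        using that by (intro semicommuting_has_sum[OF ab]) (auto simp: \<gamma>_def)
      also have "?this \<longleftrightarrow> ((\<lambda>\<beta>. a ((int m, int n) - \<beta>) * b \<beta>) has_sum 0)
          ((\<lambda>x. (int (fst x), int (snd x))) ` {x \<in> corners 0 q'. fst x \<le> m \<and> snd x \<le> n})"
      proof (rule has_sum_cong_neutral)
        fix \<beta> assume \<beta>: "\<beta> \<in> {\<beta>. \<gamma> + \<beta> \<notin> same_sign} -
          (\<lambda>x. (int (fst x), int (snd x))) ` {x \<in> corners 0 q'. fst x \<le> m \<and> snd x \<le> n}"
        obtain u v where uv: "\<beta> = (u, v)" by (cases \<beta>)
        show "a ((int m, int n) - \<beta>) * b \<beta> = 0"
        proof (rule ccontr)
          assume ne: "a ((int m, int n) - \<beta>) * b \<beta> \<noteq> 0"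
          then have mem: "(int m - u, int n - v) \<in> same_sign" "(u, v) \<in> same_sign"
            using supp uv by fastforce+
          moreover have \<gamma>\<beta>: "(u, v - int q') \<notin> same_sign"
            using \<beta> uv by (auto simp: \<gamma>_def)
          ultimately have "u \<ge> 0" "v \<ge> 0"
            by auto
          have "u \<le> int m \<and> v \<le> int n"
          proof (rule ccontr)
            assume "\<not> ?thesis"
            then have "u \<ge> int m" "v \<ge> int n" "(u, v) \<noteq> (int m, int n)"
              using mem by auto
            then have "a (- (u - int m, v - int n)) * b (u, v) = 0"
              by (intro mixed) (auto simp: zero_prod_def)
            with ne uv show False by simp
          qed
          define x where "x = (nat u, nat v)"
          have "\<beta> = (int (fst x), int (snd x))"
            using \<open>u \<ge> 0\<close> \<open>v \<ge> 0\<close> uv by (simp add: x_def)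
          moreover have "x \<in> corners 0 q'" "fst x \<le> m \<and> snd x \<le> n"
            using \<gamma>\<beta> \<open>u \<ge> 0\<close> \<open>v \<ge> 0\<close> \<open>u \<le> int m \<and> v \<le> int n\<close> by (auto simp: x_def corners_def)
          ultimately show False using \<beta> by blast
        qed
      qed (auto simp: \<gamma>_def corners_def)
      also have "\<dots> \<longleftrightarrow> (S has_sum 0) {x \<in> corners 0 q'. fst x \<le> m \<and> snd x \<le> n}"
        by (subst has_sum_reindex)
           (auto simp: inj_on_def S_def o_def prod_eq_iff intro!: has_sum_cong)
      also have "\<dots> \<longleftrightarrow> (S has_sum 0) (corners 0 q')"
        by (rule has_sum_cong_neutral) (auto simp: S_def)
      finally show ?thesis .
    qed
    have "(S has_sum 0) (corners 0 (Suc q) - corners 0 q)"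
      using that by (intro has_sum_Diff_0 sumS) (auto simp: n_def corners_def)
    also have "?this \<longleftrightarrow> (S has_sum 0) ((\<lambda>i. (i, q)) ` {1..m})"
      by (rule has_sum_cong_neutral) (auto simp: S_def corners_def image_iff)
    also have "\<dots> \<longleftrightarrow> sum S ((\<lambda>i. (i, q)) ` {1..m}) = 0"
      by (simp add: has_sum_iff)
    also have "sum S ((\<lambda>i. (i, q)) ` {1..m}) = (\<Sum>i=1..m. b (int i, int q) * a (int (m - i), int r))"
      by (subst sum.reindex) (auto simp: inj_on_def S_def n_def of_nat_diff intro!: sum.cong)
    finally show ?thesis .
  qed
  have row: "(\<forall>i. a (int i, int r) = 0) \<or> (\<forall>i>0. b (int i, int q) = 0)" if "r > 0" for q r
  proof -
    define A where "A = Abs_fps (\<lambda>i. a (int i, int r))"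
    define B where "B = Abs_fps (\<lambda>i. if i = 0 then 0 else b (int i, int q))"
    have "B * A = 0"
    proof (rule fps_ext)
      fix m
      have "fps_nth (B * A) m = (\<Sum>i=0..m. fps_nth B i * fps_nth A (m - i))"
        by (rule fps_mult_nth)
      also have "\<dots> = (\<Sum>i=1..m. b (int i, int q) * a (int (m - i), int r))"
        by (rule sum.mono_neutral_cong_right) (auto simp: A_def B_def)
      finally show "fps_nth (B * A) m = fps_nth 0 m"
        using conv[OF that] by simp
    qed
    then consider "A = 0" | "B = 0" by auto
    then show ?thesis
    proof cases
      case 1
      then show ?thesis by (auto simp: A_def fps_eq_iff)
    next
      case 2
      then have "\<forall>i. (if i = 0 then 0 else b (int i, int q)) = 0"
        by (simp add: B_def fps_eq_iff)
      then show ?thesis by (metis less_numeral_extra(3))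
    qed
  qed
  show ?thesis
  proof (rule ccontr)
    assume "\<not> ?thesis"
    then obtain \<mu> \<nu> where
      "0 \<le> fst \<mu>" "0 < snd \<mu>" "a \<mu> \<noteq> 0" "0 < fst \<nu>" "0 \<le> snd \<nu>" "b \<nu> \<noteq> 0" by blast
    then have "a (int (nat (fst \<mu>)), int (nat (snd \<mu>))) \<noteq> 0" "nat (snd \<mu>) > 0"
      "b (int (nat (fst \<nu>)), int (nat (snd \<nu>))) \<noteq> 0" "nat (fst \<nu>) > 0"
      by simp_all
    with row show False by blast
  qed
qed

text \<open>The three alternatives of the theorem in terms of coefficients. A function whose analytic part depends on
  \<open>z\<^sub>1\<close> and whose antianalytic part depends on \<open>z\<^sub>2\<close> has its spectrum on the half axes that point to the
  right and down.\<close>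

definition compatible :: "(int \<times> int \<Rightarrow> complex) \<Rightarrow> (int \<times> int \<Rightarrow> complex) \<Rightarrow> bool" where
  "compatible a b \<longleftrightarrow>
     (\<forall>c\<in>{a, b}. \<forall>\<mu>. c \<mu> \<noteq> 0 \<longrightarrow> (0 \<le> fst \<mu> \<and> snd \<mu> = 0) \<or> (fst \<mu> = 0 \<and> snd \<mu> \<le> 0)) \<or>
     (\<forall>c\<in>{a, b}. \<forall>\<mu>. c \<mu> \<noteq> 0 \<longrightarrow> (fst \<mu> = 0 \<and> 0 \<le> snd \<mu>) \<or> (fst \<mu> \<le> 0 \<and> snd \<mu> = 0)) \<or>
     (\<exists>c\<in>{a, b}. \<forall>\<mu>. \<mu> \<noteq> 0 \<longrightarrow> c \<mu> = 0)"

text \<open>\<open>Z1\<close>, \<open>Z2\<close> and \<open>C\<close> say that an analytic part depends only on \<open>z\<^sub>1\<close>, only on \<open>z\<^sub>2\<close>, or is constant;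
  \<open>a'\<close> and \<open>b'\<close> are the reflected arrays, whose analytic parts are the antianalytic parts of \<open>a\<close> and
  \<open>b\<close>. What remains is propositional reasoning from \<open>same\<close> and \<open>opp\<close>, because being constant is the
  conjunction of \<open>Z1\<close> and \<open>Z2\<close>.\<close>

lemma compatible_if_semicommuting:
  assumes ab: "semicommuting a b"
  shows "compatible a b"
proof -
  define pos where "pos = {\<mu>::int \<times> int. \<mu> \<noteq> 0 \<and> 0 \<le> fst \<mu> \<and> 0 \<le> snd \<mu>}"
  define Z1 Z2 where "Z1 c \<longleftrightarrow> (\<forall>\<mu>\<in>pos. c \<mu> \<noteq> 0 \<longrightarrow> snd \<mu> = 0)"
    and "Z2 c \<longleftrightarrow> (\<forall>\<mu>\<in>pos. c \<mu> \<noteq> 0 \<longrightarrow> fst \<mu> = 0)" for c :: "int \<times> int \<Rightarrow> complex"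
  define C where "C c \<longleftrightarrow> (\<forall>\<mu>\<in>pos. c \<mu> = 0)" for c :: "int \<times> int \<Rightarrow> complex"
  have C_iff: "C c \<longleftrightarrow> Z1 c \<and> Z2 c" for c
    by (auto simp: C_def Z1_def Z2_def pos_def prod_eq_iff)
  have same: "C a \<or> C b \<or> Z1 a \<and> Z1 b \<or> Z2 a \<and> Z2 b" if ab: "semicommuting a b" for a b
  proof -
    have "Z1 a \<or> Z2 b"
      using analytic_product_dichotomy[OF ab] unfolding Z1_def Z2_def pos_def by fastforce
    moreover have "Z2 a \<or> Z1 b"
    proof -
      have swap: "(c \<circ> prod.swap) (prod.swap \<mu>) = c \<mu>" for c :: "int \<times> int \<Rightarrow> complex" and \<mu>
        by simp
      from analytic_product_dichotomy[OF semicommuting_swap[OF ab]] show ?thesis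
      proof
        assume *: "\<forall>\<mu>. 0 \<le> fst \<mu> \<and> 0 < snd \<mu> \<longrightarrow> (a \<circ> prod.swap) \<mu> = 0"
        have "Z2 a"
          unfolding Z2_def pos_def
        proof (intro ballI impI, rule ccontr)
          fix \<mu> :: "int \<times> int" assume "\<mu> \<in> {\<mu>. \<mu> \<noteq> 0 \<and> 0 \<le> fst \<mu> \<and> 0 \<le> snd \<mu>}" "a \<mu> \<noteq> 0" "fst \<mu> \<noteq> 0"
          with *[THEN spec, of "prod.swap \<mu>"] show False unfolding swap by auto
        qed
        then show ?thesis ..
      next
        assume *: "\<forall>\<mu>. 0 < fst \<mu> \<and> 0 \<le> snd \<mu> \<longrightarrow> (b \<circ> prod.swap) \<mu> = 0"
        have "Z1 b"
          unfolding Z1_def pos_def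
        proof (intro ballI impI, rule ccontr)
          fix \<mu> :: "int \<times> int" assume "\<mu> \<in> {\<mu>. \<mu> \<noteq> 0 \<and> 0 \<le> fst \<mu> \<and> 0 \<le> snd \<mu>}" "b \<mu> \<noteq> 0" "snd \<mu> \<noteq> 0"
          with *[THEN spec, of "prod.swap \<mu>"] show False unfolding swap by auto
        qed
        then show ?thesis ..
      qed
    qed
    ultimately show ?thesis unfolding C_iff by blast
  qed
  have opp: "C a \<or> C b' \<or> Z1 a \<and> Z2 b' \<or> Z2 a \<and> Z1 b'"
    if ab: "semicommuting a b" and b': "b' = (\<lambda>\<mu>. b (- \<mu>))" for a b b'
  proof (rule ccontr)
    assume *: "\<not> ?thesis"
    have prod: "snd \<alpha> = 0 \<and> fst \<beta> = 0 \<or> fst \<alpha> = 0 \<and> snd \<beta> = 0"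
      if "\<alpha> \<in> pos" "\<beta> \<in> pos" "a \<alpha> \<noteq> 0" "b' \<beta> \<noteq> 0" for \<alpha> \<beta>
      using mixed_product_zero[OF ab, of \<alpha> \<beta>] that by (auto simp: pos_def b')
    have pos_ne: "fst \<mu> \<noteq> 0 \<or> snd \<mu> \<noteq> 0" if "\<mu> \<in> pos" for \<mu>
      using that by (auto simp: pos_def prod_eq_iff)
    from * obtain \<alpha> \<beta> where \<alpha>\<beta>: "\<alpha> \<in> pos" "\<beta> \<in> pos" "a \<alpha> \<noteq> 0" "b' \<beta> \<noteq> 0"
      unfolding C_def by blast
    show False
    proof (cases "snd \<alpha> = 0")
      case True
      then have "fst \<alpha> \<noteq> 0" using pos_ne \<alpha>\<beta> by blast
      then have "Z2 b'" unfolding Z2_def using prod[OF \<alpha>\<beta>(1) _ \<alpha>\<beta>(3)] by blast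
      then have "snd \<beta> \<noteq> 0" using pos_ne \<alpha>\<beta> unfolding Z2_def by blast
      then have "Z1 a" unfolding Z1_def using prod[OF _ \<alpha>\<beta>(2) _ \<alpha>\<beta>(4)] by blast
      with \<open>Z2 b'\<close> * show False by blast
    next
      case False
      then have "Z1 b'" unfolding Z1_def using prod[OF \<alpha>\<beta>(1) _ \<alpha>\<beta>(3)] by blast
      then have "fst \<beta> \<noteq> 0" using pos_ne \<alpha>\<beta> unfolding Z1_def by blast
      then have "Z2 a" unfolding Z2_def using prod[OF _ \<alpha>\<beta>(2) _ \<alpha>\<beta>(4)] by blast
      with \<open>Z1 b'\<close> * show False by blast
    qed
  qed
  define a' b' where "a' = (\<lambda>\<mu>. a (- \<mu>))" and "b' = (\<lambda>\<mu>. b (- \<mu>))"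
  have ab': "semicommuting a' b'"
    unfolding a'_def b'_def by (rule semicommuting_uminus[OF ab])
  have eqs: "b' = (\<lambda>\<mu>. b (- \<mu>))" "b = (\<lambda>\<mu>. b' (- \<mu>))"
    by (simp_all add: b'_def)
  have combined: "C a \<and> C a' \<or> C b \<and> C b' \<or> (Z1 a \<and> Z1 b \<and> Z2 a' \<and> Z2 b') \<or> (Z2 a \<and> Z2 b \<and> Z1 a' \<and> Z1 b')"
    using same[OF ab] same[OF ab'] opp[OF ab eqs(1)] opp[OF ab' eqs(2)] unfolding C_iff by argo
  have cases: "\<mu> = 0 \<or> \<mu> \<in> pos \<or> - \<mu> \<in> pos" if "c \<mu> \<noteq> 0" "c = a \<or> c = b" for c \<mu>
    using semicommuting_support[OF ab, of \<mu>] that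
    by (cases \<mu>) (auto simp: pos_def zero_prod_def)
  have const: "\<forall>\<mu>. \<mu> \<noteq> 0 \<longrightarrow> c \<mu> = 0"
    if "C c" "C (\<lambda>\<mu>. c (- \<mu>))" "c = a \<or> c = b" for c
  proof (intro allI impI, rule ccontr)
    fix \<mu> assume "\<mu> \<noteq> 0" "c \<mu> \<noteq> 0"
    with cases[OF _ that(3), of \<mu>] bspec[OF that(1)[unfolded C_def], of \<mu>]
      bspec[OF that(2)[unfolded C_def], of "- \<mu>"] show False by auto
  qed
  have ax1: "(0 \<le> fst \<mu> \<and> snd \<mu> = 0) \<or> (fst \<mu> = 0 \<and> snd \<mu> \<le> 0)"
    if "Z1 c" "Z2 (\<lambda>\<mu>. c (- \<mu>))" "c = a \<or> c = b" "c \<mu> \<noteq> 0" for c \<mu>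
    using cases[OF that(4,3)] bspec[OF that(1)[unfolded Z1_def], of \<mu>]
      bspec[OF that(2)[unfolded Z2_def], of "- \<mu>"] that(4) by (auto simp: pos_def)
  have ax2: "(fst \<mu> = 0 \<and> 0 \<le> snd \<mu>) \<or> (fst \<mu> \<le> 0 \<and> snd \<mu> = 0)"
    if "Z2 c" "Z1 (\<lambda>\<mu>. c (- \<mu>))" "c = a \<or> c = b" "c \<mu> \<noteq> 0" for c \<mu>
    using cases[OF that(4,3)] bspec[OF that(1)[unfolded Z2_def], of \<mu>]
      bspec[OF that(2)[unfolded Z1_def], of "- \<mu>"] that(4) by (auto simp: pos_def)
  from combined consider "C a" "C a'" | "C b" "C b'"
    | "Z1 a" "Z1 b" "Z2 a'" "Z2 b'" | "Z2 a" "Z2 b" "Z1 a'" "Z1 b'"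
    by argo
  then show ?thesis
  proof cases
    case 1
    then have "\<forall>\<mu>. \<mu> \<noteq> 0 \<longrightarrow> a \<mu> = 0" unfolding a'_def by (intro const) simp_all
    then show ?thesis unfolding compatible_def by blast
  next
    case 2
    then have "\<forall>\<mu>. \<mu> \<noteq> 0 \<longrightarrow> b \<mu> = 0" unfolding b'_def by (intro const) simp_all
    then show ?thesis unfolding compatible_def by blast
  next
    case 3
    then have "Z1 c" "Z2 (\<lambda>\<mu>. c (- \<mu>))" if "c \<in> {a, b}" for c
      using that by (auto simp: a'_def b'_def)
    then have "\<forall>c\<in>{a, b}. \<forall>\<mu>. c \<mu> \<noteq> 0 \<longrightarrow> (0 \<le> fst \<mu> \<and> snd \<mu> = 0) \<or> (fst \<mu> = 0 \<and> snd \<mu> \<le> 0)"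
      using ax1 by (metis insert_iff singletonD)
    then show ?thesis
      unfolding compatible_def by (rule disjI1)
  next
    case 4
    then have "Z2 c" "Z1 (\<lambda>\<mu>. c (- \<mu>))" if "c \<in> {a, b}" for c
      using that by (auto simp: a'_def b'_def)
    then have "\<forall>c\<in>{a, b}. \<forall>\<mu>. c \<mu> \<noteq> 0 \<longrightarrow> (fst \<mu> = 0 \<and> 0 \<le> snd \<mu>) \<or> (fst \<mu> \<le> 0 \<and> snd \<mu> = 0)"
      using ax2 by (metis insert_iff singletonD)
    then show ?thesis
      unfolding compatible_def by (intro disjI2[OF disjI1])
  qed
qed

text \<open>For spectra on the half axes pointing right and down, \<open>\<mu> - \<gamma>\<close> and \<open>\<delta> - \<mu>\<close> both point to the lower
  right. A path from \<open>\<gamma>\<close> to \<open>\<delta>\<close> with \<open>\<gamma>\<close> and \<open>\<delta>\<close> in \<open>same_sign\<close> would have to pass outside at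
  \<open>\<mu>\<close>: if \<open>\<mu>\<close> is in the open lower right quadrant it cannot return, and if \<open>\<mu>\<close> is in the open upper
  left quadrant it cannot have come from \<open>\<gamma>\<close>.\<close>

lemma no_transition_if_compatible:
  assumes "compatible a b" "\<mu> \<notin> same_sign"
  shows "(\<forall>\<delta>\<in>same_sign. a (\<delta> - \<mu>) = 0) \<or> (\<forall>\<gamma>\<in>same_sign. b (\<mu> - \<gamma>) = 0)"
proof (rule ccontr)
  assume "\<not> ?thesis"
  then obtain \<delta> \<gamma> where *: "\<delta> \<in> same_sign" "\<gamma> \<in> same_sign" "a (\<delta> - \<mu>) \<noteq> 0" "b (\<mu> - \<gamma>) \<noteq> 0"
    by blast
  from assms(1) consider
      "\<forall>c\<in>{a, b}. \<forall>\<mu>. c \<mu> \<noteq> 0 \<longrightarrow> (0 \<le> fst \<mu> \<and> snd \<mu> = 0) \<or> (fst \<mu> = 0 \<and> snd \<mu> \<le> 0)"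
    | "\<forall>c\<in>{a, b}. \<forall>\<mu>. c \<mu> \<noteq> 0 \<longrightarrow> (fst \<mu> = 0 \<and> 0 \<le> snd \<mu>) \<or> (fst \<mu> \<le> 0 \<and> snd \<mu> = 0)"
    | "\<forall>\<mu>. \<mu> \<noteq> 0 \<longrightarrow> a \<mu> = 0" | "\<forall>\<mu>. \<mu> \<noteq> 0 \<longrightarrow> b \<mu> = 0"
    unfolding compatible_def by blast
  then show False
  proof cases
    case 1
    from bspec[OF 1, of a, THEN spec, of "\<delta> - \<mu>"] bspec[OF 1, of b, THEN spec, of "\<mu> - \<gamma>"] *
    have "0 \<le> fst (\<delta> - \<mu>)" "snd (\<delta> - \<mu>) \<le> 0" "0 \<le> fst (\<mu> - \<gamma>)" "snd (\<mu> - \<gamma>) \<le> 0"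
      by auto
    with *(1,2) assms(2) show False by (auto simp: same_sign_def)
  next
    case 2
    from bspec[OF 2, of a, THEN spec, of "\<delta> - \<mu>"] bspec[OF 2, of b, THEN spec, of "\<mu> - \<gamma>"] *
    have "fst (\<delta> - \<mu>) \<le> 0" "0 \<le> snd (\<delta> - \<mu>)" "fst (\<mu> - \<gamma>) \<le> 0" "0 \<le> snd (\<mu> - \<gamma>)"
      by auto
    with *(1,2) assms(2) show False by (auto simp: same_sign_def)
  next
    case 3
    with * have "\<delta> - \<mu> = 0" by blast
    with * assms(2) show False by simp
  next
    case 4
    with * have "\<mu> - \<gamma> = 0" by blast
    with * assms(2) show False by simp
  qed
qed

section \<open>Products of Toeplitz operators\<close>

lemma compatible_coef_iff:
  assumes f: "f \<in> h2_torus" and g: "g \<in> h2_torus"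
  shows "compatible (coef f) (coef g) \<longleftrightarrow>
    ((depends_only_z1 (plus_part f) \<and> depends_only_z1 (plus_part g) \<and>
      depends_only_z2 (minus_part f) \<and> depends_only_z2 (minus_part g)) \<or>
     (depends_only_z2 (plus_part f) \<and> depends_only_z2 (plus_part g) \<and>
      depends_only_z1 (minus_part f) \<and> depends_only_z1 (minus_part g)) \<or>
     (ae_constant f \<or> ae_constant g))"
proof -
  have A: "depends_only_z1 (plus_part u) \<and> depends_only_z2 (minus_part u) \<longleftrightarrow>
      (\<forall>\<mu>. coef u \<mu> \<noteq> 0 \<longrightarrow> (0 \<le> fst \<mu> \<and> snd \<mu> = 0) \<or> (fst \<mu> = 0 \<and> snd \<mu> \<le> 0))" (is "?L1 \<longleftrightarrow> ?R1")
    and B: "depends_only_z2 (plus_part u) \<and> depends_only_z1 (minus_part u) \<longleftrightarrow>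
      (\<forall>\<mu>. coef u \<mu> \<noteq> 0 \<longrightarrow> (fst \<mu> = 0 \<and> 0 \<le> snd \<mu>) \<or> (fst \<mu> \<le> 0 \<and> snd \<mu> = 0))" (is "?L2 \<longleftrightarrow> ?R2")
    if u: "u \<in> h2_torus" for u
  proof -
    note off = coef_closed_span_off[OF u[unfolded h2_torus_eq]]
    have sign: "(0 \<le> fst \<mu> \<and> 0 \<le> snd \<mu>) \<or> (fst \<mu> \<le> 0 \<and> snd \<mu> \<le> 0)" if "coef u \<mu> \<noteq> 0" for \<mu>
      using off[of \<mu>] that unfolding same_sign_def by blast
    note simps = depends_only_z1_iff[OF plus_part_h2(1)[OF u]] depends_only_z2_iff[OF plus_part_h2(1)[OF u]]
      depends_only_z1_iff[OF minus_part_h2(1)[OF u]] depends_only_z2_iff[OF minus_part_h2(1)[OF u]]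
      plus_part_h2(2)[OF u] minus_part_h2(2)[OF u]
    have "?L1 \<longleftrightarrow> (\<forall>\<mu>. coef u \<mu> \<noteq> 0 \<longrightarrow> (if \<mu> \<in> quadrant then snd \<mu> = 0 else fst \<mu> = 0))"
      unfolding simps all_conj_distrib[symmetric] by (intro all_cong1) auto
    also have "\<dots> \<longleftrightarrow> ?R1"
      by (intro all_cong1 imp_cong refl) (drule sign, auto simp: quadrant_def)
    finally show "?L1 \<longleftrightarrow> ?R1" .
    have "?L2 \<longleftrightarrow> (\<forall>\<mu>. coef u \<mu> \<noteq> 0 \<longrightarrow> (if \<mu> \<in> quadrant then fst \<mu> = 0 else snd \<mu> = 0))"
      unfolding simps all_conj_distrib[symmetric] by (intro all_cong1) auto
    also have "\<dots> \<longleftrightarrow> ?R2"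
      by (intro all_cong1 imp_cong refl) (drule sign, auto simp: quadrant_def)
    finally show "?L2 \<longleftrightarrow> ?R2" .
  qed
  have pair: "(\<forall>c\<in>{coef f, coef g}. R c) \<longleftrightarrow> R (coef f) \<and> R (coef g)"
    "(\<exists>c\<in>{coef f, coef g}. R c) \<longleftrightarrow> R (coef f) \<or> R (coef g)" for R
    by simp_all
  show ?thesis
    unfolding compatible_def pair A[OF f, symmetric] A[OF g, symmetric] B[OF f, symmetric] B[OF g, symmetric]
      ae_constant_iff[OF f[unfolded h2_torus_eq]] ae_constant_iff[OF g[unfolded h2_torus_eq]]
    by argo
qed

lemma toeplitz_h2:
  assumes "f \<in> Linf_torus" "h \<in> L2_torus"
  shows "toeplitz f h \<in> closed_span same_sign"
    and "coef (toeplitz f h) \<mu> = (if \<mu> \<in> same_sign then coef (\<lambda>z. f z * h z) \<mu> else 0)"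
  using orth_proj_closed_span[OF L2_torus_Linf_mult[OF assms], of same_sign]
  by (simp_all add: toeplitz_def Q_proj_def h2_torus_eq)

lemma Linf_torus_mult:
  assumes "f \<in> Linf_torus" "g \<in> Linf_torus"
  shows "(\<lambda>z. f z * g z) \<in> Linf_torus"
proof -
  from assms obtain C D where "AE z in torus_haar. cmod (f z) \<le> C" "AE z in torus_haar. cmod (g z) \<le> D"
    by (auto simp: Linf_torus_def)
  then have "AE z in torus_haar. cmod (f z * g z) \<le> C * D"
  proof eventually_elim
    case (elim z)
    then show ?case
      unfolding norm_mult by (intro mult_mono) (auto intro: order_trans[OF norm_ge_zero])
  qed
  with assms show ?thesis
    by (auto simp: Linf_torus_def)
qed

text \<open>With \<open>w = gh - Q (gh)\<close>, whose spectrum avoids \<open>same_sign\<close>, the two sides agree if and only if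
  \<open>Q (fw) = 0\<close>.\<close>

lemma toeplitz_product_iff:
  assumes f: "f \<in> h2_torus" "f \<in> Linf_torus" and g: "g \<in> Linf_torus" and h: "h \<in> L2_torus"
  shows "(AE z in torus_haar. toeplitz f (toeplitz g h) z = toeplitz (\<lambda>w. f w * g w) h z) \<longleftrightarrow>
    (\<forall>\<delta>\<in>same_sign.
      ((\<lambda>\<mu>. coef f (\<delta> - \<mu>) * coef (\<lambda>z. g z * h z) \<mu>) has_sum 0) (- same_sign))"
proof -
  have f': "f \<in> closed_span UNIV"
    using f(1) closed_span_mono[of same_sign UNIV] by (auto simp: h2_torus_eq)
  define q where "q = toeplitz g h"
  define w where "w z = g z * h z - q z" for z
  note q = toeplitz_h2[OF g h, folded q_def]
  have qL2: "q \<in> L2_torus" and ghL2: "(\<lambda>z. g z * h z) \<in> L2_torus"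
    using closed_span_L2[OF q(1)] L2_torus_Linf_mult[OF g h] by auto
  have wL2: "w \<in> L2_torus"
    unfolding w_def[abs_def] using ghL2 qL2 by (rule L2_torus_diff)
  have coef_w: "coef w \<mu> = (if \<mu> \<in> same_sign then 0 else coef (\<lambda>z. g z * h z) \<mu>)" for \<mu>
    unfolding w_def[abs_def] by (simp add: coef_diff ghL2 qL2 q(2))
  note lhs = toeplitz_h2[OF f(2) qL2]
  note rhs = toeplitz_h2[OF Linf_torus_mult[OF f(2) g] h]
  have "(\<lambda>z. f z * w z) = (\<lambda>z. f z * g z * h z - f z * q z)"
    by (simp add: w_def algebra_simps)
  then have coef_fw: "coef (\<lambda>z. f z * w z) \<delta> = coef (\<lambda>z. f z * g z * h z) \<delta> - coef (\<lambda>z. f z * q z) \<delta>" for \<delta>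
    by (simp add: coef_diff L2_torus_Linf_mult f(2) qL2 Linf_torus_mult g h)
  have "(AE z in torus_haar. toeplitz f q z = toeplitz (\<lambda>w. f w * g w) h z) \<longleftrightarrow>
      (\<forall>\<delta>\<in>same_sign. coef (toeplitz f q) \<delta> = coef (toeplitz (\<lambda>w. f w * g w) h) \<delta>)"
  proof
    assume "AE z in torus_haar. toeplitz f q z = toeplitz (\<lambda>w. f w * g w) h z"
    then show "\<forall>\<delta>\<in>same_sign. coef (toeplitz f q) \<delta> = coef (toeplitz (\<lambda>w. f w * g w) h) \<delta>"
      using coef_cong_AE[OF closed_span_L2[OF lhs(1)] closed_span_L2[OF rhs(1)]] by blast
  next
    assume "\<forall>\<delta>\<in>same_sign. coef (toeplitz f q) \<delta> = coef (toeplitz (\<lambda>w. f w * g w) h) \<delta>"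
    then show "AE z in torus_haar. toeplitz f q z = toeplitz (\<lambda>w. f w * g w) h z"
      by (intro closed_span_eqI[OF lhs(1) rhs(1)]) blast
  qed
  also have "\<dots> \<longleftrightarrow> (\<forall>\<delta>\<in>same_sign. coef (\<lambda>z. f z * w z) \<delta> = 0)"
    by (rule ball_cong) (auto simp: lhs(2) rhs(2) coef_fw)
  also have "\<dots> \<longleftrightarrow> (\<forall>\<delta>\<in>same_sign.
      ((\<lambda>\<mu>. coef f (\<delta> - \<mu>) * coef (\<lambda>z. g z * h z) \<mu>) has_sum 0) (- same_sign))"
  proof (rule ball_cong[OF refl])
    fix \<delta>
    have "((\<lambda>\<mu>. coef f (\<delta> - \<mu>) * coef w \<mu>) has_sum coef (\<lambda>z. f z * w z) \<delta>) UNIV"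
      by (rule coef_mult_has_sum[OF f' f(2) wL2])
    also have "?this \<longleftrightarrow> ((\<lambda>\<mu>. coef f (\<delta> - \<mu>) * coef (\<lambda>z. g z * h z) \<mu>) has_sum
        coef (\<lambda>z. f z * w z) \<delta>) (- same_sign)"
      by (rule has_sum_cong_neutral) (auto simp: coef_w)
    finally show "coef (\<lambda>z. f z * w z) \<delta> = 0 \<longleftrightarrow>
        ((\<lambda>\<mu>. coef f (\<delta> - \<mu>) * coef (\<lambda>z. g z * h z) \<mu>) has_sum 0) (- same_sign)"
      using has_sum_unique by auto
  qed
  finally show ?thesis unfolding q_def .
qed

text \<open>For necessity the operator identity is tested on characters. Sufficiency holds term by term: each
  coefficient of \<open>gh\<close> that \<open>f\<close> could carry back into \<open>same_sign\<close> is itself zero.\<close>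

lemma toeplitz_product_iff_compatible:
  assumes f: "f \<in> h2_torus" "f \<in> Linf_torus" and g: "g \<in> h2_torus" "g \<in> Linf_torus"
  shows "(\<forall>h\<in>h2_torus. AE z in torus_haar.
      toeplitz f (toeplitz g h) z = toeplitz (\<lambda>w. f w * g w) h z) \<longleftrightarrow> compatible (coef f) (coef g)"
proof
  note f' = f(1)[unfolded h2_torus_eq] and g' = g(1)[unfolded h2_torus_eq]
  {
    assume *: "\<forall>h\<in>h2_torus. AE z in torus_haar.
      toeplitz f (toeplitz g h) z = toeplitz (\<lambda>w. f w * g w) h z"
    have "semicommuting (coef f) (coef g)"
      unfolding semicommuting_def
    proof (intro conjI allI impI ballI)
      fix \<mu> assume "\<mu> \<notin> same_sign"
      then show "coef f \<mu> = 0" "coef g \<mu> = 0"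
        using coef_closed_span_off f' g' by blast+
    next
      fix \<gamma> \<delta> assume "\<gamma> \<in> same_sign" "\<delta> \<in> same_sign"
      then have "character \<gamma> \<in> h2_torus"
        by (simp add: h2_torus_eq character_in_closed_span)
      with * toeplitz_product_iff[OF f g(2) L2_character, of \<gamma>] \<open>\<delta> \<in> same_sign\<close>
      show "((\<lambda>\<mu>. coef f (\<delta> - \<mu>) * coef g (\<mu> - \<gamma>)) has_sum 0) (- same_sign)"
        by (simp add: coef_mult_character)
    qed
    then show "compatible (coef f) (coef g)"
      by (rule compatible_if_semicommuting)
  next
    assume comp: "compatible (coef f) (coef g)"
    show "\<forall>h\<in>h2_torus. AE z in torus_haar.
      toeplitz f (toeplitz g h) z = toeplitz (\<lambda>w. f w * g w) h z"
    proof
      fix h assume "h \<in> h2_torus"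
      then have h: "h \<in> closed_span same_sign" by (simp add: h2_torus_eq)
      have g'': "g \<in> closed_span UNIV"
        using g' closed_span_mono[of same_sign UNIV] by auto
      have "coef f (\<delta> - \<mu>) * coef (\<lambda>z. g z * h z) \<mu> = 0"
        if "\<delta> \<in> same_sign" "\<mu> \<notin> same_sign" for \<delta> \<mu>
      proof (cases "coef f (\<delta> - \<mu>) = 0")
        case False
        with no_transition_if_compatible[OF comp that(2)] that(1)
        have zero: "coef g (\<mu> - \<gamma>) = 0" if "\<gamma> \<in> same_sign" for \<gamma>
          using that by blast
        have "coef g (\<mu> - \<gamma>) * coef h \<gamma> = 0" for \<gamma>
          using zero coef_closed_span_off[OF h] by (cases "\<gamma> \<in> same_sign") simp_all
        then have "((\<lambda>\<gamma>. coef g (\<mu> - \<gamma>) * coef h \<gamma>) has_sum 0) UNIV"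
          by (intro has_sum_0)
        then have "coef (\<lambda>z. g z * h z) \<mu> = 0"
          using coef_mult_has_sum[OF g'' g(2) closed_span_L2[OF h]] has_sum_unique by blast
        then show ?thesis by simp
      qed simp
      then show "AE z in torus_haar. toeplitz f (toeplitz g h) z = toeplitz (\<lambda>w. f w * g w) h z"
        unfolding toeplitz_product_iff[OF f g(2) closed_span_L2[OF h]]
        by (intro ballI has_sum_0) simp
    qed
  }
qed

theorem theorem1p6:
  fixes f g :: "complex \<times> complex \<Rightarrow> complex"
  assumes "f \<in> h2_torus" and "f \<in> Linf_torus"
    and "g \<in> h2_torus" and "g \<in> Linf_torus"
  shows "(\<forall>h\<in>h2_torus. AE z in torus_haar.
            toeplitz f (toeplitz g h) z = toeplitz (\<lambda>w. f w * g w) h z) \<longleftrightarrow>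
         ((depends_only_z1 (plus_part f) \<and> depends_only_z1 (plus_part g) \<and>
           depends_only_z2 (minus_part f) \<and> depends_only_z2 (minus_part g)) \<or>
          (depends_only_z2 (plus_part f) \<and> depends_only_z2 (plus_part g) \<and>
           depends_only_z1 (minus_part f) \<and> depends_only_z1 (minus_part g)) \<or>
          (ae_constant f \<or> ae_constant g))"
  unfolding toeplitz_product_iff_compatible[OF assms] compatible_coef_iff[OF assms(1,3)] ..

end
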